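(* Let $\mathfrak{g}$ be a Lie algebra over $K$. Let $\mathcal{LI}(\mathfrak{g})$ be the set of left ideals $I$ of $\mathcal{U}(\mathfrak{g})$ such that $\mathcal{U}_+(\mathfrak{g})=\mathfrak{g}\oplus I$, and let $\mathcal{GM}(\mathfrak{g})$ be the set of isomorphism classes of good pointed $\mathfrak{g}$-modules. The following map is well-defined and is a bijection: $$\Theta:\mathcal{LI}(\mathfrak{g})\longrightarrow\mathcal{GM}(\mathfrak{g}),\qquad I\longmapsto(\mathcal{U}(\mathfrak{g})/I,\overline{1}),$$ where $\overline{1}$ is the class of $1$ in $\mathcal{U}(\mathfrak{g})/I$.
   Context: $K$ is a commutative field of characteristic zero. $\mathcal{U}(\mathfrak{g})$ is the enveloping algebra of $\mathfrak{g}$ and $\mathcal{U}_+(\mathfrak{g})$ its augmentation ideal; $\mathfrak{g}$ is identified with its image in $\mathcal{U}(\mathfrak{g})$, and direct sums are of vector spaces. A pointed $\mathfrak{g}$-module is a couple $(M,m)$ with $M$ a $\mathfrak{g}$-module and $m\in M$; an isomorphism $(M,m)\to(M',m')$ of pointed modules is an isomorphism of $\mathfrak{g}$-modules sending $m$ to $m'$. For a pointed module $(M,m)$, define $\Upsilon_m:\mathfrak{g}\to M$, $x\mapsto x.m$. The pointed module $(M,m)$ is good if: (i) $\Upsilon_m$ is injective; (ii) $Im(\Upsilon_m)$ is a submodule of $M$ which does not contain $m$; (iii) $M/Im(\Upsilon_m)$ is isomorphic, as a $\mathfrak{g}$-module, to the trivial one-dimensional module $K$. *)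

theory Defs
  imports
    "HOL-Library.Poly_Mapping"
    "HOL-Algebra.Module"
    "HOL-Algebra.QuotRing"
    "HOL-Algebra.Algebraic_Closure_Type"
begin

section \<open>Lie algebras\<close>

locale lie_algebra = vector_space scale
  for scale :: "'k::field \<Rightarrow> 'g::ab_group_add \<Rightarrow> 'g" +
  fixes bracket :: "'g \<Rightarrow> 'g \<Rightarrow> 'g"
  assumes bracket_add_left: "bracket (x + y) z = bracket x z + bracket y z"
    and bracket_add_right: "bracket x (y + z) = bracket x y + bracket x z"
    and bracket_scale_left: "bracket (scale c x) y = scale c (bracket x y)"
    and bracket_scale_right: "bracket x (scale c y) = scale c (bracket x y)"
    and bracket_self: "bracket x x = 0"
    and jacobi: "bracket x (bracket y z) + bracket y (bracket z x) + bracket z (bracket x y) = 0"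

section \<open>Modules over a Lie algebra\<close>

text \<open>Modules live on carrier sets because the quotients \<open>U(g)/I\<close> vary with \<open>I\<close>.
  As for \<^locale>\<open>module\<close>, the fields \<^const>\<open>monoid.mult\<close> and \<^const>\<open>one\<close> inherited
  from the record of rings carry no information for a module.\<close>

record ('k, 'g, 'm) lie_mod = "('k, 'm) module" +
  act :: "'g \<Rightarrow> 'm \<Rightarrow> 'm"

locale lie_module = lie_algebra scale bracket + module "ring_of_type_algebra :: 'k ring" M
  for scale :: "'k::field \<Rightarrow> 'g::ab_group_add \<Rightarrow> 'g"
    and bracket :: "'g \<Rightarrow> 'g \<Rightarrow> 'g"
    and M :: "('k, 'g, 'm) lie_mod" (structure) +
  assumes act_closed: "v \<in> carrier M \<Longrightarrow> act M x v \<in> carrier M"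
    and act_add_left: "v \<in> carrier M \<Longrightarrow> act M (x + y) v = act M x v \<oplus>\<^bsub>M\<^esub> act M y v"
    and act_scale_left: "v \<in> carrier M \<Longrightarrow> act M (scale c x) v = c \<odot>\<^bsub>M\<^esub> act M x v"
    and act_add_right: "v \<in> carrier M \<Longrightarrow> w \<in> carrier M \<Longrightarrow>
          act M x (v \<oplus>\<^bsub>M\<^esub> w) = act M x v \<oplus>\<^bsub>M\<^esub> act M x w"
    and act_smult_right: "v \<in> carrier M \<Longrightarrow> act M x (c \<odot>\<^bsub>M\<^esub> v) = c \<odot>\<^bsub>M\<^esub> act M x v"
    and act_bracket: "v \<in> carrier M \<Longrightarrow>
          act M (bracket x y) v = act M x (act M y v) \<ominus>\<^bsub>M\<^esub> act M y (act M x v)"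

definition lie_submodule :: "'m set \<Rightarrow> ('k::field, 'g, 'm) lie_mod \<Rightarrow> bool" where
  "lie_submodule N M \<longleftrightarrow>
     submodule N (ring_of_type_algebra :: 'k ring) M \<and> (\<forall>x. \<forall>v\<in>N. act M x v \<in> N)"

text \<open>For a submodule \<open>N\<close>, each union below is over cosets that are all equal
  (compare \<^const>\<open>rcoset_mult\<close>).\<close>

definition lie_quotient :: "('k, 'g, 'm) lie_mod \<Rightarrow> 'm set \<Rightarrow> ('k, 'g, 'm set) lie_mod" where
  "lie_quotient M N =
     \<lparr>carrier = a_rcosets\<^bsub>M\<^esub> N, monoid.mult = (\<lambda>_ _. undefined), one = undefined,
      zero = N, add = set_add M,
      module.smult = (\<lambda>c C. \<Union>v\<in>C. N +>\<^bsub>M\<^esub> (c \<odot>\<^bsub>M\<^esub> v)),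
      act = (\<lambda>x C. \<Union>v\<in>C. N +>\<^bsub>M\<^esub> act M x v)\<rparr>"

definition trivial_lie_module :: "('k::field, 'g, 'k) lie_mod" where
  "trivial_lie_module =
     \<lparr>carrier = UNIV, monoid.mult = (*), one = 1, zero = 0, add = (+), module.smult = (*), act = (\<lambda>_ _. 0)\<rparr>"

definition lie_module_iso :: "('k, 'g, 'm) lie_mod \<Rightarrow> ('k, 'g, 'n) lie_mod \<Rightarrow> ('m \<Rightarrow> 'n) set" where
  "lie_module_iso M N = {f. bij_betw f (carrier M) (carrier N) \<and>
     (\<forall>v\<in>carrier M. \<forall>w\<in>carrier M. f (v \<oplus>\<^bsub>M\<^esub> w) = f v \<oplus>\<^bsub>N\<^esub> f w) \<and>
     (\<forall>c. \<forall>v\<in>carrier M. f (c \<odot>\<^bsub>M\<^esub> v) = c \<odot>\<^bsub>N\<^esub> f v) \<and>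
     (\<forall>x. \<forall>v\<in>carrier M. f (act M x v) = act N x (f v))}"

section \<open>Good pointed modules\<close>

type_synonym ('k, 'g, 'm) pointed_lie_mod = "('k, 'g, 'm) lie_mod \<times> 'm"

definition pointed_isomorphic ::
    "('k, 'g, 'm) pointed_lie_mod \<Rightarrow> ('k, 'g, 'n) pointed_lie_mod \<Rightarrow> bool" where
  "pointed_isomorphic P Q \<longleftrightarrow> (\<exists>f\<in>lie_module_iso (fst P) (fst Q). f (snd P) = snd Q)"

definition Upsilon :: "('k, 'g, 'm) lie_mod \<Rightarrow> 'm \<Rightarrow> 'g \<Rightarrow> 'm" where
  "Upsilon M m x = act M x m"

definition good_pointed ::
    "('k::field \<Rightarrow> 'g::ab_group_add \<Rightarrow> 'g) \<Rightarrow> ('g \<Rightarrow> 'g \<Rightarrow> 'g) \<Rightarrow>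
     ('k, 'g, 'm) pointed_lie_mod \<Rightarrow> bool" where
  "good_pointed scale bracket = (\<lambda>(M, m).
     lie_module scale bracket M \<and> m \<in> carrier M \<and>
     inj (Upsilon M m) \<and>
     lie_submodule (range (Upsilon M m)) M \<and> m \<notin> range (Upsilon M m) \<and>
     lie_module_iso (lie_quotient M (range (Upsilon M m))) trivial_lie_module \<noteq> {})"

definition good_pointed_iso_rel ::
    "('k::field \<Rightarrow> 'g::ab_group_add \<Rightarrow> 'g) \<Rightarrow> ('g \<Rightarrow> 'g \<Rightarrow> 'g) \<Rightarrow>
     ('k, 'g, 'm) pointed_lie_mod rel" where
  "good_pointed_iso_rel scale bracket =
     {(P, Q). good_pointed scale bracket P \<and> good_pointed scale bracket Q \<and> pointed_isomorphic P Q}"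

text \<open>The isomorphism classes of good pointed modules whose elements are taken from
  the type \<open>'m\<close>.\<close>

definition GM ::
    "('k::field \<Rightarrow> 'g::ab_group_add \<Rightarrow> 'g) \<Rightarrow> ('g \<Rightarrow> 'g \<Rightarrow> 'g) \<Rightarrow>
     ('k, 'g, 'm) pointed_lie_mod set set" where
  "GM scale bracket = {P. good_pointed scale bracket P} // good_pointed_iso_rel scale bracket"

section \<open>The enveloping algebra\<close>

text \<open>\<open>'g word\<close> is the free monoid on \<open>'g\<close>, written additively so that
  \<open>'g word \<Rightarrow>\<^sub>0 'k\<close> with the convolution product is the free associative unital
  \<open>'k\<close>-algebra on the underlying set of \<open>'g\<close>.\<close>

datatype 'g word = Word "'g list"

instantiation word :: (type) monoid_add
begin

definition zero_word :: "'a word" where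
  "zero_word = Word []"

fun plus_word :: "'a word \<Rightarrow> 'a word \<Rightarrow> 'a word" where
  "plus_word (Word u) (Word v) = Word (u @ v)"

instance
proof
  fix a b c :: "'a word"
  show "a + b + c = a + (b + c)" by (cases a; cases b; cases c) simp
  show "0 + a = a" by (cases a) (simp add: zero_word_def)
  show "a + 0 = a" by (cases a) (simp add: zero_word_def)
qed

end

type_synonym ('k, 'g) free_alg = "'g word \<Rightarrow>\<^sub>0 'k"

definition free_gen :: "'g \<Rightarrow> ('k::field, 'g) free_alg" where
  "free_gen x = Poly_Mapping.single (Word [x]) 1"

definition free_const :: "'k::field \<Rightarrow> ('k, 'g) free_alg" where
  "free_const c = Poly_Mapping.single 0 c"

text \<open>The first two families of relations cut the free algebra on the set \<open>'g\<close> down to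
  the tensor algebra of the vector space \<open>'g\<close>; the third one is the defining relation of
  the enveloping algebra.\<close>

definition env_relations ::
    "('k::field \<Rightarrow> 'g::ab_group_add \<Rightarrow> 'g) \<Rightarrow> ('g \<Rightarrow> 'g \<Rightarrow> 'g) \<Rightarrow> ('k, 'g) free_alg set" where
  "env_relations scale bracket =
     {free_gen (x + y) - free_gen x - free_gen y | x y. True} \<union>
     {free_gen (scale c x) - free_const c * free_gen x | c x. True} \<union>
     {free_gen x * free_gen y - free_gen y * free_gen x - free_gen (bracket x y) | x y. True}"

definition env_ideal ::
    "('k::field \<Rightarrow> 'g::ab_group_add \<Rightarrow> 'g) \<Rightarrow> ('g \<Rightarrow> 'g \<Rightarrow> 'g) \<Rightarrow> ('k, 'g) free_alg set" where
  "env_ideal scale bracket =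
     Idl\<^bsub>(ring_of_type_algebra :: ('k, 'g) free_alg ring)\<^esub> (env_relations scale bracket)"

definition env_ring ::
    "('k::field \<Rightarrow> 'g::ab_group_add \<Rightarrow> 'g) \<Rightarrow> ('g \<Rightarrow> 'g \<Rightarrow> 'g) \<Rightarrow> ('k, 'g) free_alg set ring" where
  "env_ring scale bracket =
     (ring_of_type_algebra :: ('k, 'g) free_alg ring) Quot (env_ideal scale bracket)"

definition env_class ::
    "('k::field \<Rightarrow> 'g::ab_group_add \<Rightarrow> 'g) \<Rightarrow> ('g \<Rightarrow> 'g \<Rightarrow> 'g) \<Rightarrow>
     ('k, 'g) free_alg \<Rightarrow> ('k, 'g) free_alg set" where
  "env_class scale bracket f =
     env_ideal scale bracket +>\<^bsub>(ring_of_type_algebra :: ('k, 'g) free_alg ring)\<^esub> f"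

text \<open>The canonical map from the Lie algebra to its enveloping algebra.\<close>

definition env_emb ::
    "('k::field \<Rightarrow> 'g::ab_group_add \<Rightarrow> 'g) \<Rightarrow> ('g \<Rightarrow> 'g \<Rightarrow> 'g) \<Rightarrow> 'g \<Rightarrow> ('k, 'g) free_alg set" where
  "env_emb scale bracket x = env_class scale bracket (free_gen x)"

text \<open>The enveloping algebra as a ring with scalars, which is at the same time a module over
  the Lie algebra by left multiplication.\<close>

definition U ::
    "('k::field \<Rightarrow> 'g::ab_group_add \<Rightarrow> 'g) \<Rightarrow> ('g \<Rightarrow> 'g \<Rightarrow> 'g) \<Rightarrow>
     ('k, 'g, ('k, 'g) free_alg set) lie_mod" where
  "U scale bracket =
     \<lparr>carrier = carrier (env_ring scale bracket),
      monoid.mult = monoid.mult (env_ring scale bracket),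
      one = one (env_ring scale bracket),
      zero = zero (env_ring scale bracket),
      add = add (env_ring scale bracket),
      module.smult = (\<lambda>c u. env_class scale bracket (free_const c) \<otimes>\<^bsub>env_ring scale bracket\<^esub> u),
      act = (\<lambda>x u. env_emb scale bracket x \<otimes>\<^bsub>env_ring scale bracket\<^esub> u)\<rparr>"

text \<open>The counit sends every element of the Lie algebra to \<open>0\<close>.  On the free algebra this
  is the constant coefficient, which vanishes on the relations, so all representatives of a
  class give the same value.\<close>

definition counit :: "('k::field, 'g) free_alg set \<Rightarrow> 'k" where
  "counit u = the_elem ((\<lambda>f. Poly_Mapping.lookup f 0) ` u)"

definition U_plus ::
    "('k::field \<Rightarrow> 'g::ab_group_add \<Rightarrow> 'g) \<Rightarrow> ('g \<Rightarrow> 'g \<Rightarrow> 'g) \<Rightarrow> ('k, 'g) free_alg set set" where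
  "U_plus scale bracket = a_kernel (U scale bracket) (ring_of_type_algebra :: 'k ring) counit"

definition left_ideal :: "'a set \<Rightarrow> ('a, 'b) ring_scheme \<Rightarrow> bool" where
  "left_ideal I R \<longleftrightarrow> additive_subgroup I R \<and> (\<forall>r\<in>carrier R. \<forall>a\<in>I. r \<otimes>\<^bsub>R\<^esub> a \<in> I)"

text \<open>The last two conjuncts say that \<^const>\<open>U_plus\<close> is the internal direct sum of the
  image of the Lie algebra and \<open>I\<close>.\<close>

definition LI ::
    "('k::field \<Rightarrow> 'g::ab_group_add \<Rightarrow> 'g) \<Rightarrow> ('g \<Rightarrow> 'g \<Rightarrow> 'g) \<Rightarrow> ('k, 'g) free_alg set set set" where
  "LI scale bracket = {I. left_ideal I (U scale bracket) \<and>
     U_plus scale bracket = range (env_emb scale bracket) <+>\<^bsub>U scale bracket\<^esub> I \<and>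
     range (env_emb scale bracket) \<inter> I = {\<zero>\<^bsub>U scale bracket\<^esub>}}"

section \<open>The map from left ideals to good pointed modules\<close>

definition U_quotient_pointed ::
    "('k::field \<Rightarrow> 'g::ab_group_add \<Rightarrow> 'g) \<Rightarrow> ('g \<Rightarrow> 'g \<Rightarrow> 'g) \<Rightarrow> ('k, 'g) free_alg set set \<Rightarrow>
     ('k, 'g, ('k, 'g) free_alg set set) pointed_lie_mod" where
  "U_quotient_pointed scale bracket I =
     (lie_quotient (U scale bracket) I, I +>\<^bsub>U scale bracket\<^esub> \<one>\<^bsub>U scale bracket\<^esub>)"

definition Theta ::
    "('k::field \<Rightarrow> 'g::ab_group_add \<Rightarrow> 'g) \<Rightarrow> ('g \<Rightarrow> 'g \<Rightarrow> 'g) \<Rightarrow> ('k, 'g) free_alg set set \<Rightarrow>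
     ('k, 'g, ('k, 'g) free_alg set set) pointed_lie_mod set" where
  "Theta scale bracket I =
     good_pointed_iso_rel scale bracket `` {U_quotient_pointed scale bracket I}"

end

theory Submission
  imports Defs
begin

text \<open>The annihilator of \<open>m\<close> recovers \<open>I\<close> from \<open>(U(g)/I, 1)\<close>, and condition (iii) on a good
  pointed module amounts to a functional \<open>\<epsilon>\<close> on \<open>M\<close> that kills \<open>g.M\<close>, does not kill \<open>m\<close>, and has the image
  of \<open>\<Upsilon>\<^sub>m\<close> as kernel.  Hence \<open>M = Im \<Upsilon>\<^sub>m \<oplus> K m\<close>, so that \<open>m\<close> generates \<open>M\<close>, and since \<open>\<epsilon> (u.m)\<close> is the
  counit of \<open>u\<close> times \<open>\<epsilon> m\<close>, the annihilator is a complement of \<open>g\<close> in the augmentation ideal.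

  In the other direction, injectivity of \<open>\<Upsilon>\<close> on \<open>U(g)/I\<close> needs that \<open>g\<close> embeds into \<open>U(g)\<close>.  This part
  of the Poincare--Birkhoff--Witt theorem is obtained from a retraction of the free algebra onto \<open>g\<close> that
  kills the defining relations: the degree one part of the sorted normal form of a word, whose
  independence of the order of the straightening steps is a diamond argument.\<close>

section \<open>Straightening of words\<close>

context lie_algebra
begin

text \<open>\<open>extend_basis {}\<close> is a fixed basis of \<open>g\<close>, so only the values
  of \<open>h\<close> on basis elements enter.\<close>

definition basis_map :: "('g \<Rightarrow> 'g) \<Rightarrow> 'g \<Rightarrow> 'g" where
  "basis_map = vector_space_pair.construct scale scale (extend_basis {})"

lemma
  shows linear_basis_map: "Vector_Spaces.linear scale scale (basis_map h)"
    and basis_map_basis: "b \<in> extend_basis {} \<Longrightarrow> basis_map h b = h b"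
    and basis_map_fun_add: "basis_map (\<lambda>b. h b + h' b) x = basis_map h x + basis_map h' x"
    and basis_map_fun_scale: "basis_map (\<lambda>b. scale c (h b)) x = scale c (basis_map h x)"
proof -
  interpret vector_space_pair scale scale ..
  have B: "independent (extend_basis {})"
    by (intro independent_extend_basis independent_empty)
  show "Vector_Spaces.linear scale scale (basis_map h)"
    unfolding basis_map_def by (rule linear_construct[OF B])
  show "b \<in> extend_basis {} \<Longrightarrow> basis_map h b = h b"
    unfolding basis_map_def by (rule construct_basis[OF B])
  show "basis_map (\<lambda>b. h b + h' b) x = basis_map h x + basis_map h' x"
    unfolding basis_map_def by (rule construct_add[OF B])
  show "basis_map (\<lambda>b. scale c (h b)) x = scale c (basis_map h x)"
    unfolding basis_map_def by (rule construct_scale[OF B])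
qed

lemma basis_map_add: "basis_map h (x + y) = basis_map h x + basis_map h y"
  and basis_map_scale: "basis_map h (scale c x) = scale c (basis_map h x)"
  and basis_map_neg: "basis_map h (- x) = - basis_map h x"
  and basis_map_zero: "basis_map h 0 = 0"
proof -
  interpret vector_space_pair scale scale ..
  note lin = linear_basis_map[of h]
  show "basis_map h (x + y) = basis_map h x + basis_map h y" by (rule linear_add[OF lin])
  show "basis_map h (scale c x) = scale c (basis_map h x)" by (rule linear_scale[OF lin])
  show "basis_map h (- x) = - basis_map h x" by (rule linear_neg[OF lin])
  show "basis_map h 0 = 0" by (rule linear_0[OF lin])
qed

lemma basis_map_eqI:
  assumes f: "\<And>x y. f (x + y) = f x + f y" "\<And>c x. f (scale c x) = scale c (f x)"
    and eq: "\<And>b. b \<in> extend_basis {} \<Longrightarrow> h b = f b"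
  shows "basis_map h x = f x"
proof -
  interpret vector_space_pair scale scale ..
  show ?thesis
  proof (rule linear_eq_on[OF linear_basis_map])
    show "Vector_Spaces.linear scale scale f"
      unfolding Vector_Spaces.linear_iff by (auto simp: f vector_space_axioms)
    show "x \<in> span (extend_basis {})" by (simp add: independent_empty)
    show "basis_map h b = f b" if "b \<in> extend_basis {}" for b
      using that by (simp add: basis_map_basis eq)
  qed
qed

text \<open>Both sides are the bilinear extension of \<open>h\<close>: they are linear in
  \<open>x\<close>, and for a basis element \<open>b\<close> in place of \<open>x\<close> both
  reduce to \<open>basis_map (h b) y\<close>.\<close>

lemma basis_map_swap:
  "basis_map (\<lambda>b. basis_map (\<lambda>c. h b c) y) x = basis_map (\<lambda>c. basis_map (\<lambda>b. h b c) x) y"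
  by (rule basis_map_eqI)
    (simp_all add: basis_map_add basis_map_scale basis_map_fun_add basis_map_fun_scale basis_map_basis)

text \<open>Exposes recursive calls below \<open>basis_map\<close> in a function definition. The
  bound letter is arbitrary there, so termination has to be shown for every letter, not just for
  basis elements.\<close>

lemma basis_map_cong [fundef_cong]: "(\<And>b. h b = h' b) \<Longrightarrow> x = y \<Longrightarrow> basis_map h x = basis_map h' y"
  by presburger

text \<open>On words of length n this is the n-linear map that agrees with \<open>G\<close> on words
  of basis elements.\<close>

fun multi_ext :: "('g list \<Rightarrow> 'g) \<Rightarrow> 'g list \<Rightarrow> 'g" where
  "multi_ext G [] = G []"
| "multi_ext G (x # xs) = basis_map (\<lambda>b. multi_ext (\<lambda>ys. G (b # ys)) xs) x"

lemma multi_ext_append: "multi_ext G (u @ v) = multi_ext (\<lambda>p. multi_ext (\<lambda>q. G (p @ q)) v) u"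
  by (induction u arbitrary: G) simp_all

lemma multi_ext_fun_add: "multi_ext (\<lambda>w. G w + H w) u = multi_ext G u + multi_ext H u"
  by (induction u arbitrary: G H) (simp_all add: basis_map_fun_add)

lemma multi_ext_fun_scale: "multi_ext (\<lambda>w. scale c (G w)) u = scale c (multi_ext G u)"
  by (induction u arbitrary: G) (simp_all add: basis_map_fun_scale)

lemma multi_ext_add:
  "multi_ext G (u @ (x + y) # v) = multi_ext G (u @ x # v) + multi_ext G (u @ y # v)"
  by (simp add: multi_ext_append basis_map_add multi_ext_fun_add)

lemma multi_ext_scale: "multi_ext G (u @ (scale c x) # v) = scale c (multi_ext G (u @ x # v))"
  by (simp add: multi_ext_append basis_map_scale multi_ext_fun_scale)

text \<open>The variable \<open>x\<close> acts as one more slot, and slots may be expanded in any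
  order by \<open>basis_map_swap\<close>.\<close>

lemma multi_ext_basis_map:
  "multi_ext (\<lambda>w. basis_map (\<lambda>b. G b w) x) u = basis_map (\<lambda>b. multi_ext (G b) u) x"
proof (induction u arbitrary: G)
  case (Cons a u)
  show ?case
    unfolding multi_ext.simps Cons by (rule basis_map_swap)
qed simp

section \<open>The order of the letters and the recursion that sorts words\<close>

lemma bracket_anti: "bracket x y = - bracket y x"
proof -
  have "bracket x y + bracket y x = 0"
    using bracket_self[of "x + y"] unfolding bracket_add_left bracket_add_right
    by (simp add: bracket_self add.commute)
  then show ?thesis by (simp add: eq_neg_iff_add_eq_0)
qed

text \<open>The strict part of an arbitrary well-order on the underlying set of \<open>g\<close>,
  with no relation to the vector space structure.\<close>

definition letter_less :: "'g \<Rightarrow> 'g \<Rightarrow> bool" where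
  "letter_less x y \<longleftrightarrow> x \<noteq> y \<and> (x, y) \<in> (SOME r. well_order_on UNIV r)"

lemma letter_order: "well_order_on UNIV (SOME r :: 'g rel. well_order_on UNIV r)"
  by (rule someI_ex) (rule well_order_on)

lemma letter_less_total: "x \<noteq> y \<Longrightarrow> letter_less x y \<or> letter_less y x"
  using letter_order by (auto simp: letter_less_def well_order_on_def linear_order_on_def total_on_def)

lemma letter_less_asym: "letter_less x y \<Longrightarrow> \<not> letter_less y x"
  using letter_order
  by (auto simp: letter_less_def well_order_on_def linear_order_on_def partial_order_on_def antisym_def)

lemma letter_less_trans: "letter_less x y \<Longrightarrow> letter_less y z \<Longrightarrow> letter_less x z"
  using letter_order letter_less_asym[of x y]
  by (auto simp: letter_less_def well_order_on_def linear_order_on_def partial_order_on_def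
      preorder_on_def trans_def)

fun inversions :: "'g list \<Rightarrow> nat" where
  "inversions [] = 0"
| "inversions (x # xs) = length (filter (\<lambda>y. letter_less y x) xs) + inversions xs"

text \<open>A letter of \<open>u\<close> has the same letters to its right before and after the
  swap, so only the pair \<open>b\<close>, \<open>c\<close> changes its contribution.\<close>

lemma inversions_swap:
  "letter_less c b \<Longrightarrow> inversions (u @ c # b # v) < inversions (u @ b # c # v)"
  by (induction u) (use letter_less_asym in auto)

definition descent :: "'g list \<Rightarrow> 'g list \<times> 'g \<times> 'g \<times> 'g list \<Rightarrow> bool" where
  "descent w = (\<lambda>(u, b, c, v). w = u @ b # c # v \<and> letter_less c b)"

text \<open>Every element of \<open>g\<close> is a letter here, without any linearity in the letters.  The values on words
  of basis elements are what counts: \<open>multi_ext\<close> extends them multilinearly.\<close>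

function straighten :: "'g list \<Rightarrow> 'g" where
  "straighten w =
    (if \<exists>d. descent w d then
       let d = SOME d. descent w d;
           u = fst d; b = fst (snd d); c = fst (snd (snd d)); v = snd (snd (snd d))
       in straighten (u @ c # b # v) + basis_map (\<lambda>x. straighten (u @ x # v)) (bracket b c)
     else if length w = 1 then hd w else 0)"
  by pat_completeness auto
termination
\<comment> \<open>The swapped word has the same length and fewer inversions; the word with a bracket
  letter is shorter, whatever letter \<open>x\<close> is inserted.\<close>
proof (relation "measures [length, inversions]")
  fix w d u b c v x
  assume "\<exists>d. descent w d" and d: "d = (SOME d. descent w d)"
    and uv: "u = fst d" "b = fst (snd d)" "c = fst (snd (snd d))" "v = snd (snd (snd d))"
  then have "descent w d" by (metis someI_ex)
  then have w: "w = u @ b # c # v" "letter_less c b"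
    unfolding uv descent_def by auto
  then show "(u @ c # b # v, w) \<in> measures [length, inversions]"
    and "(u @ x # v, w) \<in> measures [length, inversions]"
    by (simp_all add: inversions_swap)
qed simp

declare straighten.simps [simp del]

lemma straighten_single: "straighten [x] = x"
proof -
  have "\<not> descent [x] d" for d
    by (cases d) (auto simp: descent_def Cons_eq_append_conv)
  then show ?thesis by (subst straighten.simps) simp
qed

text \<open>Only the middle letter is expanded in the basis. With a bracket as that letter this is
  the correction term in the recursion of \<open>straighten\<close>.\<close>

definition slot :: "'g list \<Rightarrow> 'g \<Rightarrow> 'g list \<Rightarrow> 'g" where
  "slot u x v = basis_map (\<lambda>d. straighten (u @ d # v)) x"

text \<open>The outcome of making the first step at the pair \<open>b\<close>, \<open>c\<close>
  instead of at the descent chosen by the recursion. Nothing is required of the order of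
  \<open>b\<close> and \<open>c\<close>, so the relation \<open>straighten = straighten_at\<close>
  makes sense at every adjacent pair.\<close>

definition straighten_at :: "'g list \<Rightarrow> 'g \<Rightarrow> 'g \<Rightarrow> 'g list \<Rightarrow> 'g" where
  "straighten_at u b c v = straighten (u @ c # b # v) + slot u (bracket b c) v"

text \<open>If some descent exists, the choice operator returns one, but not necessarily the given
  one. Comparing the two is the task of the confluence argument.\<close>

lemma straighten_descent:
  assumes "letter_less c b" and w: "w = u @ b # c # v"
  obtains u' b' c' v' where "w = u' @ b' # c' # v'" "letter_less c' b'"
    "straighten w = straighten_at u' b' c' v'"
proof -
  have ex: "\<exists>d. descent w d"
    using assms by (auto simp: descent_def)
  obtain u' b' c' v' where d: "(SOME d. descent w d) = (u', b', c', v')"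
    by (metis prod_cases4)
  have "descent w (u', b', c', v')"
    using someI_ex[OF ex] d by simp
  moreover have "straighten w = straighten_at u' b' c' v'"
    using ex by (subst straighten.simps) (simp add: d straighten_at_def slot_def)
  ultimately show ?thesis
    using that by (auto simp: descent_def)
qed

section \<open>Independence of the order of the straightening steps\<close>

lemma slot_add: "slot u (x + y) v = slot u x v + slot u y v"
  and slot_scale: "slot u (scale c x) v = scale c (slot u x v)"
  and slot_neg: "slot u (- x) v = - slot u x v"
  and slot_zero: "slot u 0 v = 0"
  by (simp_all add: slot_def basis_map_add basis_map_scale basis_map_neg basis_map_zero)

lemma slot_fun_bracket_right: "basis_map (\<lambda>d. slot u (bracket d y) v) x = slot u (bracket x y) v"
  by (rule basis_map_eqI)
    (simp_all add: bracket_add_left bracket_scale_left slot_add slot_scale)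

text \<open>Making both steps in either order gives the same four terms; the one with both brackets
  is a double linear extension, symmetric by \<open>basis_map_swap\<close>. The assumptions
  \<open>short\<close> and \<open>small\<close> are the induction hypotheses of
  \<open>straighten_descending\<close>: every adjacent pair in a shorter word, and every descent in
  a word of equal length with fewer inversions.\<close>

lemma straighten_at_disjoint:
  assumes short: "\<And>u b c v. length (u @ b # c # v) < length w \<Longrightarrow> straighten (u @ b # c # v) = straighten_at u b c v"
    and small: "\<And>u b c v. length (u @ b # c # v) = length w \<Longrightarrow>
      inversions (u @ b # c # v) < inversions w \<Longrightarrow> letter_less c b \<Longrightarrow>
      straighten (u @ b # c # v) = straighten_at u b c v"
    and w: "w = u @ b # c # r @ b' # c' # v"
    and less: "letter_less c b" "letter_less c' b'"
  shows "straighten_at u b c (r @ b' # c' # v) = straighten_at (u @ b # c # r) b' c' v"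
proof -
  let ?S = straighten
  have 1: "?S (u @ c # b # r @ b' # c' # v)
    = ?S (u @ c # b # r @ c' # b' # v) + slot (u @ c # b # r) (bracket b' c') v"
    using small[of "u @ c # b # r" b' c' v] less inversions_swap[of c b u "r @ b' # c' # v"]
    by (simp add: w straighten_at_def)
  have 2: "?S (u @ d # r @ b' # c' # v)
      = ?S (u @ d # r @ c' # b' # v) + slot (u @ d # r) (bracket b' c') v" for d
    using short[of "u @ d # r" b' c' v] by (simp add: w straighten_at_def)
  have 3: "?S (u @ b # c # r @ c' # b' # v)
    = ?S (u @ c # b # r @ c' # b' # v) + slot u (bracket b c) (r @ c' # b' # v)"
    using small[of u b c "r @ c' # b' # v"] less inversions_swap[of c' b' "u @ b # c # r" v]
    by (simp add: w straighten_at_def)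
  have 4: "?S (u @ b # c # r @ d # v)
      = ?S (u @ c # b # r @ d # v) + slot u (bracket b c) (r @ d # v)" for d
    using short[of u b c "r @ d # v"] by (simp add: w straighten_at_def)
  have 5: "slot u (bracket b c) (r @ b' # c' # v)
    = slot u (bracket b c) (r @ c' # b' # v) +
      basis_map (\<lambda>d. basis_map (\<lambda>e. ?S (u @ d # r @ e # v)) (bracket b' c')) (bracket b c)"
    by (simp add: slot_def[of u] 2 basis_map_fun_add) (simp add: slot_def)
  have 6: "slot (u @ b # c # r) (bracket b' c') v
    = slot (u @ c # b # r) (bracket b' c') v +
      basis_map (\<lambda>e. basis_map (\<lambda>d. ?S (u @ d # r @ e # v)) (bracket b c)) (bracket b' c')"
    by (simp add: slot_def[of "u @ _"] 4 basis_map_fun_add) (simp add: slot_def)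
  show ?thesis
    by (simp add: straighten_at_def 1 3 5 6 basis_map_swap[of _ "bracket b' c'" "bracket b c"])
qed

text \<open>Resolving the overlap of two descents \<open>a > b > c\<close> in both orders leaves a difference that
  vanishes by the Jacobi identity.\<close>

lemma straighten_at_overlap:
  assumes short: "\<And>u b c v. length (u @ b # c # v) < length w \<Longrightarrow> straighten (u @ b # c # v) = straighten_at u b c v"
    and small: "\<And>u b c v. length (u @ b # c # v) = length w \<Longrightarrow>
      inversions (u @ b # c # v) < inversions w \<Longrightarrow> letter_less c b \<Longrightarrow>
      straighten (u @ b # c # v) = straighten_at u b c v"
    and w: "w = u @ a # b # c # v"
    and less: "letter_less b a" "letter_less c b"
  shows "straighten_at u a b (c # v) = straighten_at (u @ [a]) b c v"
proof -
  let ?S = straighten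
  have ca: "letter_less c a" using less letter_less_trans by blast
  have i: "inversions (u @ b # a # c # v) < inversions w"
    "inversions (u @ b # c # a # v) < inversions (u @ b # a # c # v)"
    "inversions (u @ a # c # b # v) < inversions w"
    "inversions (u @ c # a # b # v) < inversions (u @ a # c # b # v)"
    using inversions_swap[of b a u "c # v"] inversions_swap[of c a "u @ [b]" v]
      inversions_swap[of c b "u @ [a]" v] inversions_swap[of c a u "b # v"] less ca
    by (simp_all add: w)
  \<comment> \<open>Both routes end in \<open>u @ c # b # a # v\<close>: facts 1 and 2 continue
    after swapping \<open>a\<close> and \<open>b\<close>, facts 3 and 4 after swapping
    \<open>b\<close> and \<open>c\<close>.\<close>
  have 1: "?S (u @ b # a # c # v) = ?S (u @ b # c # a # v) + slot (u @ [b]) (bracket a c) v"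
    using small[of "u @ [b]" a c v] i ca by (simp add: w straighten_at_def)
  have 2: "?S (u @ b # c # a # v) = ?S (u @ c # b # a # v) + slot u (bracket b c) (a # v)"
    using small[of u b c "a # v"] i less by (simp add: w straighten_at_def)
  have 3: "?S (u @ a # c # b # v) = ?S (u @ c # a # b # v) + slot u (bracket a c) (b # v)"
    using small[of u a c "b # v"] i ca by (simp add: w straighten_at_def)
  have 4: "?S (u @ c # a # b # v) = ?S (u @ c # b # a # v) + slot (u @ [c]) (bracket a b) v"
    using small[of "u @ [c]" a b v] i less by (simp add: w straighten_at_def)
  \<comment> \<open>Each bracket occurs in both routes, but on different sides of the remaining
    letter. Moving it across that letter costs a double bracket.\<close>
  have move: "slot u x (y # v) = slot (u @ [y]) x v + slot u (bracket x y) v" for x y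
  proof -
    have "?S (u @ d # y # v) = ?S (u @ y # d # v) + slot u (bracket d y) v" for d
      using short[of u d y v] by (simp add: w straighten_at_def)
    then have "slot u x (y # v) = basis_map (\<lambda>d. ?S (u @ y # d # v)) x
        + basis_map (\<lambda>d. slot u (bracket d y) v) x"
      by (simp add: slot_def[of u x] basis_map_fun_add)
    then show ?thesis
      by (simp add: slot_fun_bracket_right) (simp add: slot_def)
  qed
  have "bracket (bracket b c) a + bracket (bracket a b) c = bracket (bracket a c) b"
  proof -
    have "bracket (bracket b c) a = - bracket a (bracket b c)"
      and "bracket (bracket a b) c = - bracket c (bracket a b)"
      and "bracket (bracket a c) b = bracket b (bracket c a)"
      using bracket_scale_right[of b "-1" "bracket a c"]
      by (auto simp: bracket_anti[of "bracket _ _"] bracket_anti[of c a])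
    moreover have "bracket b (bracket c a) = - bracket a (bracket b c) - bracket c (bracket a b)"
      using jacobi[of a b c] by (simp add: eq_diff_eq eq_neg_iff_add_eq_0 add.commute add.left_commute)
    ultimately show ?thesis by simp
  qed
  then have "slot u (bracket (bracket b c) a) v + slot u (bracket (bracket a b) c) v
    = slot u (bracket (bracket a c) b) v"
    by (metis slot_add)
  then show ?thesis
    using 1 2 3 4 move[of "bracket a b" c] move[of "bracket b c" a] move[of "bracket a c" b]
    by (simp add: straighten_at_def algebra_simps)
qed

lemma straighten_at_swap:
  assumes "straighten (u @ c # b # v) = straighten_at u c b v"
  shows "straighten (u @ b # c # v) = straighten_at u b c v"
  using assms by (simp add: straighten_at_def bracket_anti[of b c] slot_neg)

lemma straighten_at_same: "straighten (u @ b # b # v) = straighten_at u b b v"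
  by (simp add: straighten_at_def bracket_self slot_zero)

text \<open>Well-founded induction on length and then inversions. The given descent is compared with
  the one the recursion uses: equal positions are trivial, adjacent ones overlap, and all others are
  disjoint.\<close>

lemma straighten_descending: "letter_less c b \<Longrightarrow> straighten (u @ b # c # v) = straighten_at u b c v"
proof (induction "u @ b # c # v" arbitrary: u b c v
    rule: wf_induct_rule[OF wf_measures[of "[length, inversions]"]])
  case (1 u b c v)
  let ?w = "u @ b # c # v"
  have descending: "straighten (u1 @ b1 # c1 # v1) = straighten_at u1 b1 c1 v1"
    if "length (u1 @ b1 # c1 # v1) < length ?w \<or> length (u1 @ b1 # c1 # v1) = length ?w \<and>
      inversions (u1 @ b1 # c1 # v1) < inversions ?w" "letter_less c1 b1" for u1 b1 c1 v1
    using that by (intro 1) auto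
  \<comment> \<open>A letter coming from a bracket may stand in any order to its neighbours, so in
    shorter words the relation is needed at equal and ascending pairs as well.\<close>
  have short: "straighten (u1 @ b1 # c1 # v1) = straighten_at u1 b1 c1 v1"
    if "length (u1 @ b1 # c1 # v1) < length ?w" for u1 b1 c1 v1
  proof -
    consider "b1 = c1" | "letter_less c1 b1" | "letter_less b1 c1"
      using letter_less_total by blast
    then show ?thesis
    proof cases
      case 1
      show ?thesis unfolding 1 by (rule straighten_at_same)
    next
      case 2
      show ?thesis by (rule descending[OF disjI1[OF that] 2])
    next
      case 3
      have "length (u1 @ c1 # b1 # v1) < length ?w" using that by simp
      then show ?thesis by (rule straighten_at_swap[OF descending[OF disjI1 3]])
    qed
  qed
  \<comment> \<open>The left descent comes first. Below, \<open>r'\<close> is the part strictly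
    after \<open>b1\<close> and before \<open>b2\<close>: if it is empty the descents share the
    letter \<open>c1 = b2\<close>, otherwise it starts with \<open>c1\<close> and they are
    disjoint.\<close>
  have ordered: "straighten_at u1 b1 c1 v1 = straighten_at u2 b2 c2 v2"
    if w: "?w = u1 @ b1 # c1 # v1" "?w = u2 @ b2 # c2 # v2"
      and less: "letter_less c1 b1" "letter_less c2 b2" and len: "length u1 < length u2"
    for u1 b1 c1 v1 u2 b2 c2 v2
  proof -
    from w have "u1 @ b1 # c1 # v1 = u2 @ b2 # c2 # v2" by simp
    with len obtain r where u2: "u2 = u1 @ r" and r: "b1 # c1 # v1 = r @ b2 # c2 # v2" "r \<noteq> []"
      by (auto simp: append_eq_append_conv2)
    then obtain r' where r': "r = b1 # r'" "c1 # v1 = r' @ b2 # c2 # v2"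
      by (cases r) auto
    show ?thesis
    proof (cases r')
      case Nil
      then have b2: "c1 = b2" "v1 = c2 # v2" using r' by simp_all
      have "straighten_at u1 b1 c1 (c2 # v2) = straighten_at (u1 @ [b1]) c1 c2 v2"
      proof (rule straighten_at_overlap)
        show "u1 @ b1 # c1 # c2 # v2 = u1 @ b1 # c1 # c2 # v2" ..
      qed (use short descending less in \<open>simp_all only: w(1) b2 simp_thms\<close>)
      then show ?thesis using b2 u2 r' Nil by simp
    next
      case (Cons d r'')
      then have v1: "v1 = r'' @ b2 # c2 # v2" using r' by simp
      have "straighten_at u1 b1 c1 (r'' @ b2 # c2 # v2) = straighten_at (u1 @ b1 # c1 # r'') b2 c2 v2"
      proof (rule straighten_at_disjoint)
        show "u1 @ b1 # c1 # r'' @ b2 # c2 # v2 = u1 @ b1 # c1 # r'' @ b2 # c2 # v2" ..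
      qed (use short descending less in \<open>simp_all only: w(1) v1 simp_thms\<close>)
      then show ?thesis using v1 u2 r' Cons by simp
    qed
  qed
  obtain u' b' c' v' where *: "?w = u' @ b' # c' # v'" "letter_less c' b'"
    "straighten ?w = straighten_at u' b' c' v'"
    using straighten_descent[OF \<open>letter_less c b\<close> refl] by metis
  consider "length u < length u'" | "length u' < length u" | "length u = length u'" by linarith
  then show ?case
  proof cases
    case 1
    show ?thesis using ordered[OF refl *(1) \<open>letter_less c b\<close> *(2) 1] * by simp
  next
    case 2
    show ?thesis using ordered[OF *(1) refl *(2) \<open>letter_less c b\<close> 2] * by simp
  next
    case 3
    then show ?thesis using * by auto
  qed
qed

text \<open>On a descent this is a straightening step, on an ascent the same step read backwards
  with the sign of the bracket reversed, and for equal letters the bracket vanishes.\<close>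

lemma straighten_bracket:
  "straighten (u @ b # c # v) = straighten (u @ c # b # v) + slot u (bracket b c) v"
  using letter_less_total[of b c] straighten_descending[of c b u v]
    straighten_at_swap[OF straighten_descending[of b c u v]] straighten_at_same[of u b v]
  unfolding straighten_at_def by metis

section \<open>The degree one part of the normal form as a multilinear function of the
  letters\<close>

definition linear_part :: "'g list \<Rightarrow> 'g" where
  "linear_part = multi_ext straighten"

lemma linear_part_single: "linear_part [x] = x"
  unfolding linear_part_def
  by (simp add: straighten_single) (rule basis_map_eqI, simp_all)

lemma linear_part_add: "linear_part (u @ (x + y) # v) = linear_part (u @ x # v) + linear_part (u @ y # v)"
  and linear_part_scale: "linear_part (u @ scale c x # v) = scale c (linear_part (u @ x # v))"
  unfolding linear_part_def by (rule multi_ext_add, rule multi_ext_scale)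

text \<open>Expanding every slot over the basis reduces the claim to
  \<open>straighten_bracket\<close> on letters, followed by reassembling the bracket of
  \<open>x\<close> and \<open>y\<close> from brackets of basis elements.\<close>

lemma linear_part_bracket:
  "linear_part (u @ x # y # v) = linear_part (u @ y # x # v) + linear_part (u @ bracket x y # v)"
proof -
  have inner: "multi_ext (\<lambda>q. slot p z q) v = basis_map (\<lambda>d. multi_ext (\<lambda>q. straighten (p @ d # q)) v) z" for p z
    unfolding slot_def by (rule multi_ext_basis_map)
  \<comment> \<open>Bilinearity of the bracket: expanding \<open>x\<close> and \<open>y\<close>
    separately and bracketing the basis elements is the same as expanding the bracket
    itself.\<close>
  have br: "basis_map (\<lambda>b. basis_map (\<lambda>c. basis_map h (bracket b c)) y) x = basis_map h (bracket x y)" for h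
    by (rule basis_map_eqI)
      (simp_all add: bracket_add_left bracket_scale_left basis_map_add basis_map_scale,
        rule basis_map_eqI,
        simp_all add: bracket_add_right bracket_scale_right basis_map_add basis_map_scale)
  have swap: "multi_ext (\<lambda>q. straighten (p @ b # c # q)) v = multi_ext (\<lambda>q. straighten (p @ c # b # q)) v +
      basis_map (\<lambda>d. multi_ext (\<lambda>q. straighten (p @ d # q)) v) (bracket b c)" for p b c
    unfolding inner[symmetric] multi_ext_fun_add[symmetric]
    by (rule arg_cong[where f = "\<lambda>G. multi_ext G v"], rule ext, rule straighten_bracket)
  have "basis_map (\<lambda>b. basis_map (\<lambda>c. multi_ext (\<lambda>q. straighten (p @ b # c # q)) v) y) x =
      basis_map (\<lambda>b. basis_map (\<lambda>c. multi_ext (\<lambda>q. straighten (p @ b # c # q)) v) x) y +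
      basis_map (\<lambda>d. multi_ext (\<lambda>q. straighten (p @ d # q)) v) (bracket x y)" for p
    unfolding basis_map_swap[where x = y and y = x]
    by (subst swap) (simp only: basis_map_fun_add br)
  then show ?thesis
    unfolding linear_part_def multi_ext_append[of _ u] by (simp add: multi_ext_fun_add)
qed

end

section \<open>The enveloping algebra as a quotient of the free algebra\<close>

lemma poly_mapping_add_induct [case_names single add]:
  assumes single: "\<And>w c. P (Poly_Mapping.single w c)"
    and add: "\<And>f g. P f \<Longrightarrow> P g \<Longrightarrow> P (f + g)"
  shows "P f"
proof (induction f rule: update_induct)
  case const
  then show ?case using single[of undefined 0] by simp
next
  case (update f a b)
  have "Poly_Mapping.update a b f = f + Poly_Mapping.single a b"
    using update.hyps
    by (intro poly_mapping_eqI)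
      (auto simp: lookup_update lookup_add lookup_single in_keys_iff when_def)
  then show ?case using add[OF update.IH single] by simp
qed

lemma ring_of_type_algebra_simps [simp]:
  "carrier (ring_of_type_algebra :: 'a::ring_1 ring) = UNIV"
  "x \<oplus>\<^bsub>ring_of_type_algebra\<^esub> y = x + y"
  "x \<otimes>\<^bsub>ring_of_type_algebra\<^esub> y = x * y"
  "\<zero>\<^bsub>ring_of_type_algebra\<^esub> = (0 :: 'a)"
  "\<one>\<^bsub>ring_of_type_algebra\<^esub> = (1 :: 'a)"
  for x y :: "'a::ring_1"
  by (simp_all add: ring_of_type_algebra_def)

lemma ring_ring_of_type_algebra: "ring (ring_of_type_algebra :: 'a::ring_1 ring)"
proof -
  have "\<exists>y. x + y = 0" for x :: 'a
    using add.right_inverse by blast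
  then show ?thesis
    unfolding ring_of_type_algebra_def using add.right_inverse
    by unfold_locales (auto simp: algebra_simps Units_def)
qed

lemma a_inv_ring_of_type_algebra [simp]: "\<ominus>\<^bsub>ring_of_type_algebra\<^esub> x = - (x :: 'a::ring_1)"
  by (rule abelian_group.minus_equality[OF ring.is_abelian_group[OF ring_ring_of_type_algebra]])
    simp_all

lemma ideal_ring_of_type_algebraI:
  fixes I :: "'a::ring_1 set"
  assumes "0 \<in> I" "\<And>a b. a \<in> I \<Longrightarrow> b \<in> I \<Longrightarrow> a + b \<in> I"
    and l: "\<And>a x. a \<in> I \<Longrightarrow> x * a \<in> I" and r: "\<And>a x. a \<in> I \<Longrightarrow> a * x \<in> I"
  shows "ideal I ring_of_type_algebra"
proof (rule idealI[OF ring_ring_of_type_algebra])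
  have "- a \<in> I" if "a \<in> I" for a
    using l[OF that, of "-1"] by simp
  then show "subgroup I (add_monoid ring_of_type_algebra)"
    unfolding subgroup_def a_inv_def[symmetric] using assms(1,2)
    by simp
qed (use l r in auto)

primrec letters :: "'g word \<Rightarrow> 'g list" where
  "letters (Word u) = u"

lemma letters_plus [simp]: "letters (u + v) = letters u @ letters v"
  by (cases u; cases v) simp

lemma letters_zero [simp]: "letters 0 = []"
  by (simp add: zero_word_def)

lemma letters_eq_Nil [simp]: "letters w = [] \<longleftrightarrow> w = 0"
  by (cases w) (simp add: zero_word_def)

lemma word_plus_eq_zero [simp]: "u + v = 0 \<longleftrightarrow> u = 0 \<and> v = (0 :: 'g word)"
  by (simp flip: letters_eq_Nil)

lemma free_gen_const_commute: "free_gen x * free_const c = free_const c * free_gen x"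
  by (simp add: free_gen_def free_const_def mult_single)

lemma free_const_add: "free_const (c + d) = free_const c + free_const d"
  and free_const_mult: "free_const (c * d) = free_const c * free_const d"
  and free_const_one: "free_const 1 = 1"
  by (simp_all add: free_const_def single_add mult_single)

text \<open>The empty word is a product of two words only if both are empty, so taking the constant
  coefficient is multiplicative.\<close>

lemma lookup_mult_zero_word:
  "Poly_Mapping.lookup (f * g) 0 = Poly_Mapping.lookup f 0 * Poly_Mapping.lookup g (0 :: 'g word)" for f g :: "('k::field, 'g) free_alg"
proof (induction f rule: poly_mapping_add_induct)
  case (single w c)
  show ?case
    by (induction g rule: poly_mapping_add_induct)
      (auto simp: mult_single lookup_single when_def lookup_add algebra_simps)
qed (simp_all add: lookup_add algebra_simps)

lemma lookup_free_gen_zero [simp]: "Poly_Mapping.lookup (free_gen x) 0 = 0"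
  and lookup_free_const_zero [simp]: "Poly_Mapping.lookup (free_const c) 0 = c"
  by (simp_all add: free_gen_def free_const_def lookup_single zero_word_def)

section \<open>The ideal of relations and the embedding of the Lie algebra\<close>

context lie_algebra
begin

abbreviation proj :: "('k, 'g) free_alg \<Rightarrow> ('k, 'g) free_alg set" where
  "proj \<equiv> env_class scale bracket"

abbreviation rel_ideal :: "('k, 'g) free_alg set" where
  "rel_ideal \<equiv> env_ideal scale bracket"

abbreviation UE :: "('k, 'g, ('k, 'g) free_alg set) lie_mod" where
  "UE \<equiv> U scale bracket"

lemma ideal_rel_ideal: "ideal rel_ideal ring_of_type_algebra"
  unfolding env_ideal_def
  by (rule ring.genideal_ideal[OF ring_ring_of_type_algebra]) simp

lemma env_relations_subset: "env_relations scale bracket \<subseteq> rel_ideal"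
  unfolding env_ideal_def
  by (rule ring.genideal_self[OF ring_ring_of_type_algebra]) simp

lemma rel_ideal_minimal:
  "ideal I ring_of_type_algebra \<Longrightarrow> env_relations scale bracket \<subseteq> I \<Longrightarrow> rel_ideal \<subseteq> I"
  unfolding env_ideal_def by (rule ring.genideal_minimal[OF ring_ring_of_type_algebra])

definition free_linear_part :: "('k, 'g) free_alg \<Rightarrow> 'g" where
  "free_linear_part f = (\<Sum>w\<in>Poly_Mapping.keys f. scale (Poly_Mapping.lookup f w) (linear_part (letters w)))"

lemma free_linear_part_superset:
  "finite A \<Longrightarrow> Poly_Mapping.keys f \<subseteq> A \<Longrightarrow>
    free_linear_part f = (\<Sum>w\<in>A. scale (Poly_Mapping.lookup f w) (linear_part (letters w)))"
  unfolding free_linear_part_def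
  by (intro sum.mono_neutral_left) (auto simp: in_keys_iff)

lemma free_linear_part_add: "free_linear_part (f + g) = free_linear_part f + free_linear_part g"
  by (simp add: free_linear_part_superset[of "Poly_Mapping.keys f \<union> Poly_Mapping.keys g"] Poly_Mapping.keys_add
      lookup_add scale_left_distrib sum.distrib)

lemma free_linear_part_single:
  "free_linear_part (Poly_Mapping.single w c) = scale c (linear_part (letters w))"
  by (simp add: free_linear_part_superset[of "{w}"])

lemma free_linear_part_diff: "free_linear_part (f - g) = free_linear_part f - free_linear_part g"
  using free_linear_part_add[of "f - g" g] by simp

text \<open>By additivity \<open>p\<close> and \<open>q\<close> may be taken to be monomials. The
  relation then sits between two fixed words, where it is additivity, homogeneity or the bracket
  rule of \<open>linear_part\<close>.\<close>

lemma free_linear_part_relation: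
  assumes "r \<in> env_relations scale bracket"
  shows "free_linear_part (p * r * q) = 0"
proof (induction p rule: poly_mapping_add_induct)
  case (single u a)
  show ?case
  proof (induction q rule: poly_mapping_add_induct)
    case (single v b)
    note simps = free_gen_def free_const_def left_diff_distrib right_diff_distrib mult_single
      free_linear_part_diff free_linear_part_single
    consider x y where "r = free_gen (x + y) - free_gen x - free_gen y"
      | c x where "r = free_gen (scale c x) - free_const c * free_gen x"
      | x y where "r = free_gen x * free_gen y - free_gen y * free_gen x - free_gen (bracket x y)"
      using assms unfolding env_relations_def by blast
    then show ?case
    proof cases
      case 1
      then show ?thesis by (simp add: simps linear_part_add scale_right_distrib)
    next
      case 2
      then show ?thesis by (simp add: simps linear_part_scale mult.commute mult.left_commute)
    next
      case (3 x y)
      then show ?thesis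
        using linear_part_bracket[of "letters u" x y "letters v"] by (simp add: simps scale_right_distrib)
    qed
  qed (simp add: algebra_simps free_linear_part_add)
qed (simp add: algebra_simps free_linear_part_add)

lemma free_linear_part_rel_ideal:
  assumes "f \<in> rel_ideal"
  shows "free_linear_part f = 0"
proof -
  \<comment> \<open>The kernel of a linear map need not be an ideal; \<open>?Z\<close> is the
    largest two-sided ideal inside it.\<close>
  let ?Z = "{f. \<forall>p q. free_linear_part (p * f * q) = 0}"
  have "ideal ?Z ring_of_type_algebra"
  proof (rule ideal_ring_of_type_algebraI)
    show "x * a \<in> ?Z" if "a \<in> ?Z" for a x
      using that by (simp flip: mult.assoc)
    show "a * x \<in> ?Z" if "a \<in> ?Z" for a x
      using that by (simp add: mult.assoc)
  qed (auto simp: free_linear_part_single[of _ 0, simplified] algebra_simps free_linear_part_add)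
  then have "rel_ideal \<subseteq> ?Z"
    by (rule rel_ideal_minimal) (auto simp: free_linear_part_relation)
  then have "free_linear_part (1 * f * 1) = 0"
    using assms by blast
  then show ?thesis by simp
qed

lemma proj_eq_iff: "proj f = proj g \<longleftrightarrow> f - g \<in> rel_ideal"
proof -
  interpret J: ideal rel_ideal "ring_of_type_algebra :: ('k, 'g) free_alg ring"
    by (rule ideal_rel_ideal)
  show ?thesis
    unfolding env_class_def
    using J.a_rcos_module[of g f] J.a_rcos_self[of f] J.a_repr_independence'[of f g] by auto
qed

lemma mem_proj: "f \<in> proj g \<longleftrightarrow> proj f = proj g"
proof -
  interpret J: ideal rel_ideal "ring_of_type_algebra :: ('k, 'g) free_alg ring"
    by (rule ideal_rel_ideal)
  show ?thesis
    unfolding env_class_def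
    using J.a_rcos_self[of f] J.a_repr_independence'[of f g] by auto
qed

text \<open>If two generators have the same class, their difference lies in the ideal of relations,
  and the retraction sends this difference to \<open>x - y\<close>.\<close>

lemma inj_env_emb: "inj (env_emb scale bracket)"
proof (rule injI)
  fix x y assume "env_emb scale bracket x = env_emb scale bracket y"
  then have "free_linear_part (free_gen x - free_gen y) = 0"
    unfolding env_emb_def proj_eq_iff by (rule free_linear_part_rel_ideal)
  then show "x = y"
    by (simp add: free_linear_part_diff) (simp add: free_gen_def free_linear_part_single linear_part_single)
qed

lemma lookup_rel_ideal: "f \<in> rel_ideal \<Longrightarrow> Poly_Mapping.lookup f 0 = 0"
proof -
  have "rel_ideal \<subseteq> {f. Poly_Mapping.lookup f 0 = 0}"
  proof (rule rel_ideal_minimal)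
    show "ideal {f :: ('k, 'g) free_alg. Poly_Mapping.lookup f 0 = 0} ring_of_type_algebra"
      by (rule ideal_ring_of_type_algebraI) (auto simp: lookup_add lookup_mult_zero_word)
  qed (auto simp: env_relations_def lookup_minus lookup_mult_zero_word)
  then show "f \<in> rel_ideal \<Longrightarrow> Poly_Mapping.lookup f 0 = 0" by blast
qed

lemma counit_proj: "counit (proj f) = Poly_Mapping.lookup f 0"
proof -
  have "Poly_Mapping.lookup g 0 = Poly_Mapping.lookup f 0" if "g \<in> proj f" for g
    using that lookup_rel_ideal[of "g - f"] by (simp add: mem_proj proj_eq_iff lookup_minus)
  moreover have "f \<in> proj f" by (simp add: mem_proj)
  ultimately have "(\<lambda>g. Poly_Mapping.lookup g 0) ` proj f = {Poly_Mapping.lookup f 0}"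
    by (metis (no_types, lifting) image_cong image_constant)
  then show ?thesis by (simp add: counit_def)
qed

section \<open>The operations of the enveloping algebra on representatives\<close>

lemma U_carrier: "carrier UE = range proj"
  and U_one: "\<one>\<^bsub>UE\<^esub> = proj 1"
  and U_zero: "\<zero>\<^bsub>UE\<^esub> = proj 0"
  and U_add: "proj f \<oplus>\<^bsub>UE\<^esub> proj g = proj (f + g)"
  and U_mult: "proj f \<otimes>\<^bsub>UE\<^esub> proj g = proj (f * g)"
  and U_smult: "c \<odot>\<^bsub>UE\<^esub> proj f = proj (free_const c * f)"
  and U_act: "act UE x (proj f) = proj (free_gen x * f)"
proof -
  interpret J: ideal rel_ideal "ring_of_type_algebra :: ('k, 'g) free_alg ring"
    by (rule ideal_rel_ideal)
  show "carrier UE = range proj"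
    by (auto simp: U_def env_ring_def FactRing_def A_RCOSETS_def' env_class_def)
  show "\<one>\<^bsub>UE\<^esub> = proj 1"
    by (simp add: U_def env_ring_def FactRing_def env_class_def)
  show "\<zero>\<^bsub>UE\<^esub> = proj 0"
    using J.a_rcos_const[OF additive_subgroup.zero_closed[OF J.is_additive_subgroup]] by (simp add: U_def env_ring_def FactRing_def env_class_def)
  show "proj f \<oplus>\<^bsub>UE\<^esub> proj g = proj (f + g)"
    using J.a_rcos_sum[of f g] by (simp add: U_def env_ring_def FactRing_def env_class_def)
  have mult: "proj f \<otimes>\<^bsub>env_ring scale bracket\<^esub> proj g = proj (f * g)" for f g
    using J.rcoset_mult_add[of f g] by (simp add: env_ring_def FactRing_def env_class_def)
  show "proj f \<otimes>\<^bsub>UE\<^esub> proj g = proj (f * g)"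
    and "c \<odot>\<^bsub>UE\<^esub> proj f = proj (free_const c * f)"
    and "act UE x (proj f) = proj (free_gen x * f)"
    by (simp_all add: U_def mult env_emb_def)
qed

lemmas U_simps = U_carrier U_one U_zero U_add U_mult U_smult U_act

lemma U_abelian_group: "abelian_group UE"
proof (rule abelian_groupI)
  show "\<exists>y\<in>carrier UE. y \<oplus>\<^bsub>UE\<^esub> x = \<zero>\<^bsub>UE\<^esub>" if "x \<in> carrier UE" for x
  proof -
    from that obtain f where "x = proj f" by (auto simp: U_carrier)
    then have "proj (- f) \<oplus>\<^bsub>UE\<^esub> x = \<zero>\<^bsub>UE\<^esub>" by (simp add: U_simps)
    then show ?thesis by (auto simp: U_carrier)
  qed
qed (auto simp: U_simps ac_simps)

lemma U_uminus: "\<ominus>\<^bsub>UE\<^esub> proj f = proj (- f)"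
  by (rule abelian_group.minus_equality[OF U_abelian_group]) (auto simp: U_simps)

lemma U_minus: "proj f \<ominus>\<^bsub>UE\<^esub> proj g = proj (f - g)"
  by (simp add: a_minus_def U_uminus U_add)

lemma proj_relation: "f - g \<in> env_relations scale bracket \<Longrightarrow> proj (f * h) = proj (g * h)"
  using env_relations_subset ideal.I_r_closed[OF ideal_rel_ideal, of "f - g" h]
  by (auto simp: proj_eq_iff algebra_simps)

lemma proj_free_gen_add: "proj (free_gen (x + y) * h) = proj ((free_gen x + free_gen y) * h)"
  by (rule proj_relation) (force simp: env_relations_def algebra_simps)

lemma proj_free_gen_scale: "proj (free_gen (scale c x) * h) = proj (free_const c * free_gen x * h)"
  by (rule proj_relation) (force simp: env_relations_def)

lemma proj_free_gen_bracket:
  "proj (free_gen (bracket x y) * h) = proj ((free_gen x * free_gen y - free_gen y * free_gen x) * h)"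
  by (rule sym, rule proj_relation) (force simp: env_relations_def)

lemma lie_module_U: "lie_module scale bracket UE"
proof (intro lie_module.intro lie_module_axioms.intro moduleI)
  show "lie_algebra scale bracket" by (rule lie_algebra_axioms)
  show "abelian_group UE" by (rule U_abelian_group)
  show "cring (ring_of_type_algebra :: 'k ring)" ..
  fix x y :: 'g and c and v
  assume "v \<in> carrier UE"
  then obtain f where f: "v = proj f" by (auto simp: U_carrier)
  show "act UE (bracket x y) v = act UE x (act UE y v) \<ominus>\<^bsub>UE\<^esub> act UE y (act UE x v)"
    by (simp add: f U_simps U_minus proj_free_gen_bracket algebra_simps)
  show "act UE (x + y) v = act UE x v \<oplus>\<^bsub>UE\<^esub> act UE y v"
    by (simp add: f U_simps proj_free_gen_add algebra_simps)
  show "act UE (scale c x) v = c \<odot>\<^bsub>UE\<^esub> act UE x v"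
    by (simp add: f U_simps proj_free_gen_scale algebra_simps)
next
  fix c x and v assume "v \<in> carrier UE"
  then obtain f where f: "v = proj f" by (auto simp: U_carrier)
  have "free_gen x * (free_const c * f) = free_const c * (free_gen x * f)"
    by (simp add: free_gen_const_commute flip: mult.assoc)
  then show "act UE x (c \<odot>\<^bsub>UE\<^esub> v) = c \<odot>\<^bsub>UE\<^esub> act UE x v"
    by (simp add: f U_simps)
qed (auto simp: U_simps free_const_add free_const_mult free_const_one distrib_left distrib_right mult.assoc)

lemma U_plus_eq: "U_plus scale bracket = {proj f | f. Poly_Mapping.lookup f 0 = 0}"
  unfolding U_plus_def a_kernel_def' by (auto simp: U_carrier counit_proj)

end

section \<open>Homomorphisms and quotients of Lie modules\<close>

definition lie_hom :: "('k, 'g, 'm) lie_mod \<Rightarrow> ('k, 'g, 'n) lie_mod \<Rightarrow> ('m \<Rightarrow> 'n) set" where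
  "lie_hom M N = {f. f ` carrier M \<subseteq> carrier N \<and>
     (\<forall>v\<in>carrier M. \<forall>w\<in>carrier M. f (v \<oplus>\<^bsub>M\<^esub> w) = f v \<oplus>\<^bsub>N\<^esub> f w) \<and>
     (\<forall>c. \<forall>v\<in>carrier M. f (c \<odot>\<^bsub>M\<^esub> v) = c \<odot>\<^bsub>N\<^esub> f v) \<and>
     (\<forall>x. \<forall>v\<in>carrier M. f (act M x v) = act N x (f v))}"

lemma lie_homD:
  assumes "f \<in> lie_hom M N"
  shows "v \<in> carrier M \<Longrightarrow> f v \<in> carrier N"
    and "v \<in> carrier M \<Longrightarrow> w \<in> carrier M \<Longrightarrow> f (v \<oplus>\<^bsub>M\<^esub> w) = f v \<oplus>\<^bsub>N\<^esub> f w"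
    and "v \<in> carrier M \<Longrightarrow> f (c \<odot>\<^bsub>M\<^esub> v) = c \<odot>\<^bsub>N\<^esub> f v"
    and "v \<in> carrier M \<Longrightarrow> f (act M x v) = act N x (f v)"
  using assms by (auto simp: lie_hom_def)

lemma lie_module_iso_eq: "lie_module_iso M N = {f \<in> lie_hom M N. bij_betw f (carrier M) (carrier N)}"
  by (auto simp: lie_module_iso_def lie_hom_def bij_betw_def)

lemma lie_module_iso_id: "id \<in> lie_module_iso M M"
  by (simp add: lie_module_iso_eq lie_hom_def)

lemma lie_module_iso_comp:
  "f \<in> lie_module_iso M N \<Longrightarrow> g \<in> lie_module_iso N P \<Longrightarrow> g \<circ> f \<in> lie_module_iso M P"
  by (auto simp: lie_module_iso_eq lie_hom_def image_subset_iff intro: bij_betw_trans)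

section \<open>Submodules and quotient modules\<close>

context lie_module
begin

lemma lie_mod_simps [simp]:
  "v \<in> carrier M \<Longrightarrow> c \<odot>\<^bsub>M\<^esub> v \<in> carrier M"
  "v \<in> carrier M \<Longrightarrow> act M x v \<in> carrier M"
  "v \<in> carrier M \<Longrightarrow> 1 \<odot>\<^bsub>M\<^esub> v = v"
  "v \<in> carrier M \<Longrightarrow> 0 \<odot>\<^bsub>M\<^esub> v = \<zero>\<^bsub>M\<^esub>"
  "c \<odot>\<^bsub>M\<^esub> \<zero>\<^bsub>M\<^esub> = \<zero>\<^bsub>M\<^esub>"
  using smult_closed act_closed smult_one smult_l_null smult_r_null by simp_all

lemma lie_mod_distribs:
  "v \<in> carrier M \<Longrightarrow> (c + d) \<odot>\<^bsub>M\<^esub> v = c \<odot>\<^bsub>M\<^esub> v \<oplus>\<^bsub>M\<^esub> d \<odot>\<^bsub>M\<^esub> v"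
  "v \<in> carrier M \<Longrightarrow> w \<in> carrier M \<Longrightarrow> c \<odot>\<^bsub>M\<^esub> (v \<oplus>\<^bsub>M\<^esub> w) = c \<odot>\<^bsub>M\<^esub> v \<oplus>\<^bsub>M\<^esub> c \<odot>\<^bsub>M\<^esub> w"
  "v \<in> carrier M \<Longrightarrow> (c * d) \<odot>\<^bsub>M\<^esub> v = c \<odot>\<^bsub>M\<^esub> (d \<odot>\<^bsub>M\<^esub> v)"
  using smult_l_distr smult_r_distr smult_assoc1 by simp_all

lemma a_inv_eq_smult: "v \<in> carrier M \<Longrightarrow> \<ominus>\<^bsub>M\<^esub> v = (- 1) \<odot>\<^bsub>M\<^esub> v"
  using smult_l_minus[of 1 v] by simp

lemma lie_submodule_abelian_subgroup: "lie_submodule N M \<Longrightarrow> abelian_subgroup N M"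
  unfolding lie_submodule_def
  by (auto intro!: abelian_subgroupI3 additive_subgroupI abelian_group_axioms dest: submodule.axioms(1))

lemma lie_submoduleD:
  assumes "lie_submodule N M"
  shows "v \<in> N \<Longrightarrow> v \<in> carrier M" "v \<in> N \<Longrightarrow> c \<odot>\<^bsub>M\<^esub> v \<in> N" "v \<in> N \<Longrightarrow> act M x v \<in> N"
    "\<zero>\<^bsub>M\<^esub> \<in> N"
  using assms submodule.smult_closed[of N "ring_of_type_algebra" M c v]
    submodule.axioms(1)[THEN subgroup.subset, of N "ring_of_type_algebra" M]
    submodule.axioms(1)[THEN subgroup.one_closed, of N "ring_of_type_algebra" M]
  by (auto simp: lie_submodule_def)

lemma lie_submoduleI:
  assumes "additive_subgroup N M" "\<And>c v. v \<in> N \<Longrightarrow> c \<odot>\<^bsub>M\<^esub> v \<in> N" "\<And>x v. v \<in> N \<Longrightarrow> act M x v \<in> N"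
  shows "lie_submodule N M"
  using assms
  by (simp add: lie_submodule_def submodule_def submodule_axioms_def additive_subgroup_def)

context
  fixes N assumes N: "lie_submodule N M"
begin

interpretation N: abelian_subgroup N M
  by (rule lie_submodule_abelian_subgroup[OF N])

lemma coset_eq_iff:
  assumes "v \<in> carrier M" "w \<in> carrier M"
  shows "N +>\<^bsub>M\<^esub> v = N +>\<^bsub>M\<^esub> w \<longleftrightarrow> v \<ominus>\<^bsub>M\<^esub> w \<in> N"
  using assms N.a_rcos_module[of w v] N.a_rcos_self[of v] N.a_repr_independence'[of v w]
  by (auto simp: a_minus_def)

lemma mem_cosetD: "w \<in> N +>\<^bsub>M\<^esub> v \<Longrightarrow> \<exists>n\<in>N. w = n \<oplus>\<^bsub>M\<^esub> v"
  by (auto simp: a_r_coset_def')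

text \<open>The operations of \<open>lie_quotient\<close> are unions over a coset. An additive map
  that preserves \<open>N\<close> sends a whole coset into a single one, so the union collapses;
  this is applied to scalar multiplication and to the action.\<close>

lemma coset_UN:
  assumes v: "v \<in> carrier M"
    and h: "\<And>w. w \<in> carrier M \<Longrightarrow> h w \<in> carrier M" "\<And>n. n \<in> N \<Longrightarrow> h n \<in> N"
    and add: "\<And>w w'. w \<in> carrier M \<Longrightarrow> w' \<in> carrier M \<Longrightarrow> h (w \<oplus>\<^bsub>M\<^esub> w') = h w \<oplus>\<^bsub>M\<^esub> h w'"
  shows "(\<Union>w\<in>N +>\<^bsub>M\<^esub> v. N +>\<^bsub>M\<^esub> h w) = N +>\<^bsub>M\<^esub> h v"
proof -
  have "N +>\<^bsub>M\<^esub> h w = N +>\<^bsub>M\<^esub> h v" if w: "w \<in> N +>\<^bsub>M\<^esub> v" for w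
  proof -
    obtain n where "n \<in> N" "w = n \<oplus>\<^bsub>M\<^esub> v" using mem_cosetD[OF w] by blast
    then have "h w \<in> N +>\<^bsub>M\<^esub> h v"
      using v h add lie_submoduleD[OF N] by (auto intro!: a_rcosI N.a_subset)
    then show ?thesis using N.a_repr_independence' h v by blast
  qed
  then have "(\<Union>w\<in>N +>\<^bsub>M\<^esub> v. N +>\<^bsub>M\<^esub> h w) = (\<Union>w\<in>N +>\<^bsub>M\<^esub> v. N +>\<^bsub>M\<^esub> h v)"
    by (intro SUP_cong refl)
  also have "\<dots> = N +>\<^bsub>M\<^esub> h v"
    using N.a_rcos_self[OF v] by blast
  finally show ?thesis .
qed

lemma quotient_carrier: "carrier (lie_quotient M N) = (\<lambda>v. N +>\<^bsub>M\<^esub> v) ` carrier M"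
  by (auto simp: lie_quotient_def A_RCOSETS_def')

lemma quotient_zero: "\<zero>\<^bsub>lie_quotient M N\<^esub> = N +>\<^bsub>M\<^esub> \<zero>\<^bsub>M\<^esub>"
  using N.a_rcos_const[of "\<zero>\<^bsub>M\<^esub>"] lie_submoduleD(4)[OF N] by (simp add: lie_quotient_def)

lemma quotient_add:
  "v \<in> carrier M \<Longrightarrow> w \<in> carrier M \<Longrightarrow> (N +>\<^bsub>M\<^esub> v) \<oplus>\<^bsub>lie_quotient M N\<^esub> (N +>\<^bsub>M\<^esub> w) = N +>\<^bsub>M\<^esub> (v \<oplus>\<^bsub>M\<^esub> w)"
  by (simp add: lie_quotient_def N.a_rcos_sum)

lemma quotient_smult: "v \<in> carrier M \<Longrightarrow> c \<odot>\<^bsub>lie_quotient M N\<^esub> (N +>\<^bsub>M\<^esub> v) = N +>\<^bsub>M\<^esub> (c \<odot>\<^bsub>M\<^esub> v)"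
  unfolding lie_quotient_def
  by (simp, rule coset_UN) (auto simp: lie_submoduleD[OF N] lie_mod_distribs)

lemma quotient_act: "v \<in> carrier M \<Longrightarrow> act (lie_quotient M N) x (N +>\<^bsub>M\<^esub> v) = N +>\<^bsub>M\<^esub> act M x v"
  unfolding lie_quotient_def
  by (simp, rule coset_UN) (auto simp: lie_submoduleD[OF N] act_add_right)

lemmas quotient_simps = quotient_carrier quotient_zero quotient_add quotient_smult quotient_act

lemma quotient_abelian_group: "abelian_group (lie_quotient M N)"
proof (rule abelian_groupI)
  show "\<exists>y\<in>carrier (lie_quotient M N). y \<oplus>\<^bsub>lie_quotient M N\<^esub> x = \<zero>\<^bsub>lie_quotient M N\<^esub>" if "x \<in> carrier (lie_quotient M N)" for x
  proof -
    from that obtain v where v: "v \<in> carrier M" "x = N +>\<^bsub>M\<^esub> v" by (auto simp: quotient_carrier)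
    then have "(N +>\<^bsub>M\<^esub> (\<ominus>\<^bsub>M\<^esub> v)) \<oplus>\<^bsub>lie_quotient M N\<^esub> x = \<zero>\<^bsub>lie_quotient M N\<^esub>" by (simp add: quotient_simps l_neg)
    then show ?thesis using v by (auto simp: quotient_carrier)
  qed
qed (auto simp: quotient_simps a_ac)

lemma quotient_minus:
  assumes "v \<in> carrier M" "w \<in> carrier M"
  shows "(N +>\<^bsub>M\<^esub> v) \<ominus>\<^bsub>lie_quotient M N\<^esub> (N +>\<^bsub>M\<^esub> w) = N +>\<^bsub>M\<^esub> (v \<ominus>\<^bsub>M\<^esub> w)"
proof -
  have "\<ominus>\<^bsub>lie_quotient M N\<^esub> (N +>\<^bsub>M\<^esub> w) = N +>\<^bsub>M\<^esub> (\<ominus>\<^bsub>M\<^esub> w)"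
    by (rule abelian_group.minus_equality[OF quotient_abelian_group])
      (use assms in \<open>auto simp: quotient_simps l_neg\<close>)
  then show ?thesis using assms by (simp add: a_minus_def quotient_add)
qed

lemma lie_module_quotient: "lie_module scale bracket (lie_quotient M N)"
proof (intro lie_module.intro lie_module_axioms.intro moduleI)
  show "lie_algebra scale bracket" by (rule lie_algebra_axioms)
  show "abelian_group (lie_quotient M N)" by (rule quotient_abelian_group)
  show "cring (ring_of_type_algebra :: 'k ring)" ..
qed (auto simp: quotient_simps quotient_minus lie_mod_distribs act_add_left act_scale_left
    act_add_right act_smult_right act_bracket)

lemma coset_hom: "(\<lambda>v. N +>\<^bsub>M\<^esub> v) \<in> lie_hom M (lie_quotient M N)"
  by (auto simp: lie_hom_def quotient_simps)

end

end

section \<open>Homomorphism theorems and the trivial module\<close>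

lemma lie_hom_minus:
  assumes "lie_module scale bracket M" "lie_module scale bracket P"
    and f: "f \<in> lie_hom M P" and "v \<in> carrier M" "w \<in> carrier M"
  shows "f (v \<ominus>\<^bsub>M\<^esub> w) = f v \<ominus>\<^bsub>P\<^esub> f w"
  using assms
  by (simp add: a_minus_def lie_module.a_inv_eq_smult lie_module.lie_mod_simps lie_homD[OF f])

lemma lie_hom_zero:
  assumes "lie_module scale bracket M" "lie_module scale bracket P" and f: "f \<in> lie_hom M P"
  shows "f \<zero>\<^bsub>M\<^esub> = \<zero>\<^bsub>P\<^esub>"
proof -
  interpret M: lie_module scale bracket M by fact
  interpret P: lie_module scale bracket P by fact
  have "f (0 \<odot>\<^bsub>M\<^esub> \<zero>\<^bsub>M\<^esub>) = 0 \<odot>\<^bsub>P\<^esub> f \<zero>\<^bsub>M\<^esub>"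
    using lie_homD[OF f] by blast
  then show ?thesis
    using lie_homD(1)[OF f M.zero_closed] by simp
qed

lemma lie_quotient_universal:
  assumes M: "lie_module scale bracket M" and P: "lie_module scale bracket P"
    and N: "lie_submodule N M" and f: "f \<in> lie_hom M P" and ker: "\<And>v. v \<in> N \<Longrightarrow> f v = \<zero>\<^bsub>P\<^esub>"
  obtains g where "g \<in> lie_hom (lie_quotient M N) P" "\<And>v. v \<in> carrier M \<Longrightarrow> g (N +>\<^bsub>M\<^esub> v) = f v"
proof -
  interpret M: lie_module scale bracket M by fact
  interpret P: lie_module scale bracket P by fact
  note f = lie_homD[OF f] and N' = M.lie_submoduleD[OF N]
  \<comment> \<open>Since \<open>f\<close> is constant on cosets of \<open>N\<close>, the image of a
    coset is a singleton.\<close>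
  define g where "g C = the_elem (f ` C)" for C
  have g: "g (N +>\<^bsub>M\<^esub> v) = f v" if v: "v \<in> carrier M" for v
  proof -
    have "f w = f v" if "w \<in> N +>\<^bsub>M\<^esub> v" for w
      using M.mem_cosetD[OF N that] v f ker N' by auto
    moreover have "v \<in> N +>\<^bsub>M\<^esub> v"
      by (rule abelian_subgroup.a_rcos_self[OF M.lie_submodule_abelian_subgroup[OF N] v])
    ultimately have "f ` (N +>\<^bsub>M\<^esub> v) = {f v}"
      by (metis (no_types, lifting) image_cong image_constant)
    then show ?thesis by (simp add: g_def)
  qed
  have "g \<in> lie_hom (lie_quotient M N) P"
    by (auto simp: lie_hom_def M.quotient_simps[OF N] g f)
  then show thesis using that g by blast
qed

text \<open>The first isomorphism theorem, in a form that also records the value of the isomorphism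
  on each coset, which is needed to follow the base point.\<close>

lemma lie_quotient_iso:
  assumes M: "lie_module scale bracket M" and P: "lie_module scale bracket P"
    and N: "lie_submodule N M" and f: "f \<in> lie_hom M P"
    and ker: "\<And>v. v \<in> carrier M \<Longrightarrow> f v = \<zero>\<^bsub>P\<^esub> \<longleftrightarrow> v \<in> N" and onto: "f ` carrier M = carrier P"
  obtains g where "g \<in> lie_module_iso (lie_quotient M N) P" "\<And>v. v \<in> carrier M \<Longrightarrow> g (N +>\<^bsub>M\<^esub> v) = f v"
proof -
  interpret M: lie_module scale bracket M by fact
  interpret P: lie_module scale bracket P by fact
  obtain g where g: "g \<in> lie_hom (lie_quotient M N) P" "\<And>v. v \<in> carrier M \<Longrightarrow> g (N +>\<^bsub>M\<^esub> v) = f v"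
    using lie_quotient_universal[OF M P N f] ker M.lie_submoduleD[OF N] by metis
  have eq: "N +>\<^bsub>M\<^esub> v = N +>\<^bsub>M\<^esub> w" if "v \<in> carrier M" "w \<in> carrier M" "f v = f w" for v w
  proof -
    have "f (v \<ominus>\<^bsub>M\<^esub> w) = \<zero>\<^bsub>P\<^esub>"
      unfolding lie_hom_minus[OF M P f that(1,2)] unfolding a_minus_def
      using that lie_homD(1)[OF f] by (simp add: P.r_neg)
    then show ?thesis using that ker by (simp add: M.coset_eq_iff[OF N])
  qed
  have "inj_on g (carrier (lie_quotient M N))"
  proof (rule inj_onI)
    fix C D assume "C \<in> carrier (lie_quotient M N)" "D \<in> carrier (lie_quotient M N)" and CD: "g C = g D"
    then obtain v w where vw: "v \<in> carrier M" "C = N +>\<^bsub>M\<^esub> v" "w \<in> carrier M" "D = N +>\<^bsub>M\<^esub> w"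
      unfolding M.quotient_carrier[OF N] by blast
    then have "f v = f w" using CD g(2) by metis
    then show "C = D" unfolding vw(2,4) by (rule eq[OF vw(1,3)])
  qed
  moreover have "g ` carrier (lie_quotient M N) = carrier P"
    by (simp add: M.quotient_carrier[OF N] image_image g flip: onto)
  ultimately have "g \<in> lie_module_iso (lie_quotient M N) P"
    using g by (simp add: lie_module_iso_eq bij_betw_def)
  then show thesis using that g by blast
qed

lemma lie_module_iso_inv:
  assumes M: "lie_module scale bracket M" and f: "f \<in> lie_module_iso M N"
  shows "inv_into (carrier M) f \<in> lie_module_iso N M"
proof -
  interpret M: lie_module scale bracket M by fact
  have bij: "bij_betw f (carrier M) (carrier N)" and hom: "f \<in> lie_hom M N"
    using f by (auto simp: lie_module_iso_eq)
  let ?g = "inv_into (carrier M) f"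
  have N: "carrier N = f ` carrier M" using bij by (simp add: bij_betw_def)
  have [simp]: "?g (f v) = v" if "v \<in> carrier M" for v
    using that bij by (simp add: bij_betw_def)
  have "?g \<in> lie_hom N M"
    unfolding lie_hom_def N by (auto simp flip: lie_homD(2-4)[OF hom])
  then show ?thesis
    using bij_betw_inv_into[OF bij] by (simp add: lie_module_iso_eq)
qed

lemma trivial_lie_module_simps [simp]:
  "carrier trivial_lie_module = UNIV" "\<zero>\<^bsub>trivial_lie_module\<^esub> = 0"
  "a \<oplus>\<^bsub>trivial_lie_module\<^esub> b = a + b" "a \<odot>\<^bsub>trivial_lie_module\<^esub> b = a * b"
  "act trivial_lie_module x b = 0"
  by (simp_all add: trivial_lie_module_def)

lemma (in lie_algebra) lie_module_trivial:
  "lie_module scale bracket (trivial_lie_module :: ('k, 'g, 'k) lie_mod)"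
proof -
  let ?T = "trivial_lie_module :: ('k, 'g, 'k) lie_mod"
  have ab: "abelian_group ?T"
    by (rule abelian_groupI) (auto simp: add.assoc add.commute intro: exI[of _ "- _"])
  have "\<ominus>\<^bsub>?T\<^esub> 0 = 0"
    by (rule abelian_group.minus_equality[OF ab]) simp_all
  then show ?thesis
    by (intro lie_module.intro lie_module_axioms.intro moduleI lie_algebra_axioms ab cring_from_type_algebra)
      (simp_all add: algebra_simps a_minus_def)
qed

section \<open>The action of the free algebra on a Lie module\<close>

lemma lie_hom_comp: "f \<in> lie_hom M N \<Longrightarrow> g \<in> lie_hom N P \<Longrightarrow> (\<lambda>v. g (f v)) \<in> lie_hom M P"
  by (auto simp: lie_hom_def image_subset_iff)

lemma (in lie_module) coset_eq_zero_iff: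
  assumes N: "lie_submodule N M" and v: "v \<in> carrier M"
  shows "N +>\<^bsub>M\<^esub> v = \<zero>\<^bsub>lie_quotient M N\<^esub> \<longleftrightarrow> v \<in> N"
  using coset_eq_iff[OF N v zero_closed] v by (simp add: quotient_zero[OF N] a_minus_def a_inv_eq_smult)

context lie_module
begin

definition act_word :: "'g word \<Rightarrow> 'm \<Rightarrow> 'm" where
  "act_word w v = foldr (act M) (letters w) v"

text \<open>The free algebra acts instead of its quotient, so that no representatives have to be
  chosen; \<open>act_free_cong_proj\<close> later shows that only the class in the enveloping
  algebra matters.\<close>

definition act_free :: "('k, 'g) free_alg \<Rightarrow> 'm \<Rightarrow> 'm" where
  "act_free f v = (\<Oplus>\<^bsub>M\<^esub>w\<in>Poly_Mapping.keys f. Poly_Mapping.lookup f w \<odot>\<^bsub>M\<^esub> act_word w v)"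

lemma foldr_act_closed [simp]: "v \<in> carrier M \<Longrightarrow> foldr (act M) u v \<in> carrier M"
  by (induction u) simp_all

lemma act_word_closed [simp]: "v \<in> carrier M \<Longrightarrow> act_word w v \<in> carrier M"
  by (simp add: act_word_def)

lemma act_word_plus: "act_word (u + w) v = act_word u (act_word w v)"
  by (simp add: act_word_def)

lemma act_word_add:
  "v \<in> carrier M \<Longrightarrow> v' \<in> carrier M \<Longrightarrow> act_word w (v \<oplus>\<^bsub>M\<^esub> v') = act_word w v \<oplus>\<^bsub>M\<^esub> act_word w v'"
proof -
  assume "v \<in> carrier M" "v' \<in> carrier M"
  then have "foldr (act M) u (v \<oplus>\<^bsub>M\<^esub> v') = foldr (act M) u v \<oplus>\<^bsub>M\<^esub> foldr (act M) u v'" for u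
    by (induction u) (simp_all add: act_add_right)
  then show ?thesis by (simp add: act_word_def)
qed

lemma act_word_smult: "v \<in> carrier M \<Longrightarrow> act_word w (c \<odot>\<^bsub>M\<^esub> v) = c \<odot>\<^bsub>M\<^esub> act_word w v"
proof -
  assume "v \<in> carrier M"
  then have "foldr (act M) u (c \<odot>\<^bsub>M\<^esub> v) = c \<odot>\<^bsub>M\<^esub> foldr (act M) u v" for u
    by (induction u) (simp_all add: act_smult_right)
  then show ?thesis by (simp add: act_word_def)
qed

lemma act_free_superset:
  assumes "finite A" "Poly_Mapping.keys f \<subseteq> A" "v \<in> carrier M"
  shows "act_free f v = (\<Oplus>\<^bsub>M\<^esub>w\<in>A. Poly_Mapping.lookup f w \<odot>\<^bsub>M\<^esub> act_word w v)"
  unfolding act_free_def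
  by (rule add.finprod_mono_neutral_cong_left) (use assms in \<open>auto simp: in_keys_iff\<close>)

lemma act_free_closed [simp]: "v \<in> carrier M \<Longrightarrow> act_free f v \<in> carrier M"
  unfolding act_free_def by (rule finsum_closed) auto

lemma act_free_single:
  "v \<in> carrier M \<Longrightarrow> act_free (Poly_Mapping.single w c) v = c \<odot>\<^bsub>M\<^esub> act_word w v"
  by (simp add: act_free_superset[of "{w}"])

lemma act_free_add:
  assumes "v \<in> carrier M"
  shows "act_free (f + g) v = act_free f v \<oplus>\<^bsub>M\<^esub> act_free g v"
proof -
  let ?A = "Poly_Mapping.keys f \<union> Poly_Mapping.keys g"
  have "act_free (f + g) v = (\<Oplus>\<^bsub>M\<^esub>w\<in>?A. Poly_Mapping.lookup (f + g) w \<odot>\<^bsub>M\<^esub> act_word w v)"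
    by (rule act_free_superset) (use assms in \<open>simp_all add: Poly_Mapping.keys_add\<close>)
  also have "\<dots> = (\<Oplus>\<^bsub>M\<^esub>w\<in>?A. Poly_Mapping.lookup f w \<odot>\<^bsub>M\<^esub> act_word w v \<oplus>\<^bsub>M\<^esub>
      Poly_Mapping.lookup g w \<odot>\<^bsub>M\<^esub> act_word w v)"
    using assms by (simp add: lookup_add lie_mod_distribs)
  also have "\<dots> = act_free f v \<oplus>\<^bsub>M\<^esub> act_free g v"
    using assms by (simp add: act_free_superset[of ?A] finsum_addf)
  finally show ?thesis .
qed

lemma act_free_zero [simp]: "act_free 0 v = \<zero>\<^bsub>M\<^esub>"
  by (simp add: act_free_def)

lemma act_free_one [simp]: "v \<in> carrier M \<Longrightarrow> act_free 1 v = v"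
  using act_free_single[of v 0 1] by (simp add: act_word_def)

lemma act_free_gen [simp]: "v \<in> carrier M \<Longrightarrow> act_free (free_gen x) v = act M x v"
  by (simp add: free_gen_def act_free_single act_word_def)

lemma act_free_const [simp]: "v \<in> carrier M \<Longrightarrow> act_free (free_const c) v = c \<odot>\<^bsub>M\<^esub> v"
  by (simp add: free_const_def act_free_single act_word_def)

lemma act_free_uminus: "v \<in> carrier M \<Longrightarrow> act_free (- f) v = \<ominus>\<^bsub>M\<^esub> act_free f v"
  using act_free_add[of v "- f" f] by (simp add: minus_equality)

lemma act_free_diff: "v \<in> carrier M \<Longrightarrow> act_free (f - g) v = act_free f v \<ominus>\<^bsub>M\<^esub> act_free g v"
  using act_free_add[of v f "- g"] by (simp add: act_free_uminus a_minus_def)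

lemma act_free_mult:
  assumes v: "v \<in> carrier M"
  shows "act_free (f * g) v = act_free f (act_free g v)"
proof (induction f rule: poly_mapping_add_induct)
  case (single u a)
  show ?case
  proof (induction g rule: poly_mapping_add_induct)
    case (single w b)
    show ?case
      using v by (simp add: mult_single act_free_single act_word_plus act_word_smult lie_mod_distribs)
  next
    case (add g h)
    then show ?case
      using v by (simp add: distrib_left act_free_add act_free_single act_word_add lie_mod_distribs)
  qed
qed (use v in \<open>simp add: distrib_right act_free_add\<close>)

lemma act_free_at_zero: "act_free f \<zero>\<^bsub>M\<^esub> = \<zero>\<^bsub>M\<^esub>"
  using act_free_mult[of "\<zero>\<^bsub>M\<^esub>" f 0] by simp

text \<open>The annihilator of \<open>M\<close> in the free algebra is a two-sided ideal, and the
  module axioms put the defining relations into it.\<close>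

lemma act_free_rel_ideal:
  assumes "f \<in> rel_ideal" "v \<in> carrier M"
  shows "act_free f v = \<zero>\<^bsub>M\<^esub>"
proof -
  let ?Z = "{f. \<forall>v\<in>carrier M. act_free f v = \<zero>\<^bsub>M\<^esub>}"
  have "rel_ideal \<subseteq> ?Z"
  proof (rule rel_ideal_minimal)
    show "ideal ?Z ring_of_type_algebra"
      by (rule ideal_ring_of_type_algebraI) (auto simp: act_free_add act_free_mult act_free_at_zero)
    have "r \<in> ?Z" if r: "r \<in> env_relations scale bracket" for r
    proof -
      consider x y where "r = free_gen (x + y) - free_gen x - free_gen y"
        | c x where "r = free_gen (scale c x) - free_const c * free_gen x"
        | x y where "r = free_gen x * free_gen y - free_gen y * free_gen x - free_gen (bracket x y)"
        using r unfolding env_relations_def by blast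
      then show ?thesis
      proof cases
        case (1 x y)
        then have "r = free_gen (x + y) - (free_gen x + free_gen y)" by simp
        then show ?thesis
          by (simp add: act_free_diff act_free_add act_add_left) (simp add: a_minus_def r_neg)
      next
        case 2
        then show ?thesis
          by (simp add: act_free_diff act_free_mult act_scale_left) (simp add: a_minus_def r_neg)
      next
        case 3
        then show ?thesis
          by (simp add: act_free_diff act_free_mult act_bracket) (simp add: a_minus_def r_neg)
      qed
    qed
    then show "env_relations scale bracket \<subseteq> ?Z" by blast
  qed
  then show ?thesis using assms by blast
qed

lemma act_free_cong_proj: "proj f = proj g \<Longrightarrow> v \<in> carrier M \<Longrightarrow> act_free f v = act_free g v"
  using act_free_rel_ideal[of "f - g" v] act_free_add[of v "f - g" g] by (simp add: proj_eq_iff)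

end

lemma lie_hom_act_free:
  assumes M: "lie_module scale bracket M" and P: "lie_module scale bracket P"
    and f: "f \<in> lie_hom M P" and v: "v \<in> carrier M"
  shows "f (lie_module.act_free M p v) = lie_module.act_free P p (f v)"
proof -
  interpret M: lie_module scale bracket M by fact
  interpret P: lie_module scale bracket P by fact
  note f = lie_homD[OF f]
  have word: "f (foldr (act M) u v) = foldr (act P) u (f v)" for u
    using v by (induction u) (simp_all add: f)
  show ?thesis
  proof (induction p rule: poly_mapping_add_induct)
    case (single w c)
    show ?case
      using v f(1)[OF v] word[of "letters w"]
      by (simp add: M.act_free_single P.act_free_single f)
        (simp add: M.act_word_def P.act_word_def)
  next
    case (add p q)
    then show ?case
      using v f(1)[OF v] by (simp add: M.act_free_add P.act_free_add f)
  qed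
qed

context lie_algebra
begin

text \<open>On the enveloping algebra the action is left multiplication. For \<open>q = 1\<close>
  every class is thus obtained by acting on the class of 1.\<close>

lemma act_free_U: "lie_module.act_free UE p (proj q) = proj (p * q)"
proof -
  interpret UE: lie_module scale bracket UE by (rule lie_module_U)
  have q: "proj q \<in> carrier UE" by (simp add: U_carrier)
  have word: "foldr (act UE) u (proj q) = proj (Poly_Mapping.single (Word u) 1 * q)" for u
  proof (induction u)
    case Nil
    show ?case by (simp flip: zero_word_def)
  next
    case (Cons x u)
    then show ?case
      by (simp add: U_act) (simp add: free_gen_def mult_single flip: mult.assoc)
  qed
  show ?thesis
  proof (induction p rule: poly_mapping_add_induct)
    case (single w c)
    show ?case
      using q by (cases w)
        (simp add: UE.act_free_single UE.act_word_def word U_smult free_const_def mult_single flip: mult.assoc)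
  next
    case (add f g)
    then show ?case using q by (simp add: UE.act_free_add U_add distrib_right)
  qed
qed

section \<open>Good pointed modules in terms of a functional\<close>

abbreviation trivial_mod :: "('k, 'g, 'k) lie_mod" where
  "trivial_mod \<equiv> trivial_lie_module"

text \<open>From left to right, \<epsilon> is the coset map followed by the isomorphism onto the
  trivial module. From right to left, the image of \<open>Upsilon M m\<close> is the kernel of a
  homomorphism, hence a submodule, and the first isomorphism theorem identifies the
  quotient.\<close>

lemma good_pointed_iff_functional:
  "good_pointed scale bracket (M, m) \<longleftrightarrow>
    lie_module scale bracket M \<and> m \<in> carrier M \<and> inj (Upsilon M m) \<and>
    (\<exists>\<epsilon>\<in>lie_hom M trivial_mod. \<epsilon> m \<noteq> 0 \<and> (\<forall>v\<in>carrier M. \<epsilon> v = 0 \<longleftrightarrow> v \<in> range (Upsilon M m)))"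
  (is "?L \<longleftrightarrow> ?R")
proof
  let ?N = "range (Upsilon M m)"
  assume ?L
  then have M: "lie_module scale bracket M" and m: "m \<in> carrier M" "inj (Upsilon M m)" "m \<notin> ?N"
    and N: "lie_submodule ?N M" and iso: "lie_module_iso (lie_quotient M ?N) trivial_mod \<noteq> {}"
    by (auto simp: good_pointed_def)
  interpret M: lie_module scale bracket M by fact
  obtain f where f: "f \<in> lie_hom (lie_quotient M ?N) trivial_mod" "inj_on f (carrier (lie_quotient M ?N))"
    using iso by (auto simp: lie_module_iso_eq bij_betw_def)
  have "f \<zero>\<^bsub>lie_quotient M ?N\<^esub> = 0"
    using lie_hom_zero[OF M.lie_module_quotient[OF N] lie_module_trivial f(1)] by simp
  moreover have "\<zero>\<^bsub>lie_quotient M ?N\<^esub> \<in> carrier (lie_quotient M ?N)"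
    by (simp add: M.quotient_simps[OF N])
  ultimately have ker: "f (?N +>\<^bsub>M\<^esub> v) = 0 \<longleftrightarrow> v \<in> ?N" if "v \<in> carrier M" for v
    using f(2) that M.coset_eq_zero_iff[OF N that] lie_homD(1)[OF M.coset_hom[OF N] that]
    by (metis inj_onD)
  moreover have "(\<lambda>v. f (?N +>\<^bsub>M\<^esub> v)) \<in> lie_hom M trivial_mod"
    by (rule lie_hom_comp[OF M.coset_hom[OF N] f(1)])
  ultimately show ?R
    using M m by (intro conjI bexI[where x = "\<lambda>v. f (?N +>\<^bsub>M\<^esub> v)"]) auto
next
  let ?N = "range (Upsilon M m)"
  assume ?R
  then obtain \<epsilon> where M: "lie_module scale bracket M" and m: "m \<in> carrier M" "inj (Upsilon M m)"
    and \<epsilon>: "\<epsilon> \<in> lie_hom M trivial_mod" "\<epsilon> m \<noteq> 0"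
    and ker: "\<And>v. v \<in> carrier M \<Longrightarrow> \<epsilon> v = 0 \<longleftrightarrow> v \<in> ?N"
    by auto
  interpret M: lie_module scale bracket M by fact
  note hom = lie_homD[OF \<epsilon>(1), simplified]
  have N: "?N = {v \<in> carrier M. \<epsilon> v = 0}"
  proof -
    have "Upsilon M m x \<in> carrier M" for x
      using m by (simp add: Upsilon_def)
    then show ?thesis using ker by blast
  qed
  have z: "\<epsilon> \<zero>\<^bsub>M\<^esub> = 0"
    using lie_hom_zero[OF M lie_module_trivial \<epsilon>(1)] by simp
  have sub: "lie_submodule ?N M"
  proof (rule M.lie_submoduleI)
    show "additive_subgroup ?N M"
      unfolding N
      by (rule additive_subgroupI, rule group.subgroupI[OF M.a_group], unfold a_inv_def[symmetric])
        (use z in \<open>auto simp: hom M.a_inv_eq_smult\<close>)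
  qed (auto simp: N hom)
  \<comment> \<open>A nonzero value at \<open>m\<close> makes \<epsilon> surjective, since multiples
    of \<open>m\<close> reach every scalar.\<close>
  have "c \<in> \<epsilon> ` carrier M" for c
    using m \<epsilon>(2) hom(3)[of m "c / \<epsilon> m"] by (auto intro!: image_eqI[where x = "(c / \<epsilon> m) \<odot>\<^bsub>M\<^esub> m"])
  then have onto: "\<epsilon> ` carrier M = carrier trivial_mod"
    by auto
  have "\<epsilon> v = \<zero>\<^bsub>trivial_mod\<^esub> \<longleftrightarrow> v \<in> ?N" if "v \<in> carrier M" for v
    using ker[OF that] by simp
  from lie_quotient_iso[OF M lie_module_trivial sub \<epsilon>(1) this onto]
  obtain g where "g \<in> lie_module_iso (lie_quotient M ?N) trivial_mod" by blast
  then show ?L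
    using M m sub \<epsilon>(2) by (auto simp: good_pointed_def N)
qed

lemma env_emb_diff: "env_emb scale bracket (x - y) = proj (free_gen x - free_gen y)"
  using proj_free_gen_add[of "x - y" y 1, symmetric]
  by (simp add: env_emb_def proj_eq_iff algebra_simps)

lemma env_emb_zero: "env_emb scale bracket 0 = proj 0"
  using env_emb_diff[of 0 0] by simp

end

section \<open>Left ideals and good pointed modules\<close>

context lie_algebra
begin

lemma counit_hom: "counit \<in> lie_hom UE trivial_mod"
  by (auto simp: lie_hom_def U_simps counit_proj lookup_add lookup_mult_zero_word)

lemma LI_D:
  assumes "I \<in> LI scale bracket"
  shows "additive_subgroup I UE" "r \<in> carrier UE \<Longrightarrow> a \<in> I \<Longrightarrow> r \<otimes>\<^bsub>UE\<^esub> a \<in> I"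
    and "U_plus scale bracket = range (env_emb scale bracket) <+>\<^bsub>UE\<^esub> I"
    and "range (env_emb scale bracket) \<inter> I = {\<zero>\<^bsub>UE\<^esub>}"
  using assms by (auto simp: LI_def left_ideal_def)

text \<open>Scalars and elements of \<open>g\<close> both act through left multiplication by classes
  in the enveloping algebra.\<close>

lemma lie_submodule_left_ideal:
  assumes "I \<in> LI scale bracket"
  shows "lie_submodule I UE"
proof -
  interpret UE: lie_module scale bracket UE by (rule lie_module_U)
  note I = LI_D[OF assms]
  have sub: "I \<subseteq> range proj"
    using additive_subgroup.a_subset[OF I(1)] by (simp add: U_carrier)
  have mult: "proj (p * f) \<in> I" if "proj f \<in> I" for p f
    using I(2)[OF _ that, of "proj p"] by (simp add: U_simps)
  show ?thesis
    by (rule UE.lie_submoduleI[OF I(1)]) (use sub in \<open>force simp: U_simps intro: mult\<close>)+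
qed

lemma U_quotient_pointed_eq: "U_quotient_pointed scale bracket I = (lie_quotient UE I, I +>\<^bsub>UE\<^esub> proj 1)"
  by (simp add: U_quotient_pointed_def U_one)

text \<open>The counit vanishes on \<open>I\<close> and descends to the required functional on the
  quotient. Its kernel is the image of \<open>U_plus\<close>, which is the image of \<open>g\<close>
  because \<open>U_plus\<close> is \<open>g\<close> plus \<open>I\<close>. Injectivity of
  \<open>Upsilon\<close> combines the trivial intersection of \<open>g\<close> and \<open>I\<close>
  with \<open>inj_env_emb\<close>.\<close>

lemma good_pointed_U_quotient:
  assumes LI: "I \<in> LI scale bracket"
  shows "good_pointed scale bracket (U_quotient_pointed scale bracket I)"
proof -
  interpret UE: lie_module scale bracket UE by (rule lie_module_U)
  let ?Q = "lie_quotient UE I" and ?m = "I +>\<^bsub>UE\<^esub> proj 1"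
  note I = LI_D[OF LI]
  note N = lie_submodule_left_ideal[OF LI]
  note Q = UE.lie_module_quotient[OF N]
  have proj [simp]: "proj f \<in> carrier UE" for f by (simp add: U_carrier)
  have emb: "env_emb scale bracket x = proj (free_gen x)" for x by (simp add: env_emb_def)
  have Ups: "Upsilon ?Q ?m x = I +>\<^bsub>UE\<^esub> proj (free_gen x)" for x
    by (simp add: Upsilon_def UE.quotient_act[OF N] U_act)
  have U_plus_iff: "counit v = 0 \<longleftrightarrow> (\<exists>x. \<exists>i\<in>I. v = proj (free_gen x) \<oplus>\<^bsub>UE\<^esub> i)"
    if "v \<in> carrier UE" for v
  proof -
    have "counit v = 0 \<longleftrightarrow> v \<in> U_plus scale bracket"
      using that by (auto simp: U_plus_eq U_carrier counit_proj)
    then show ?thesis unfolding I(3) by (auto simp: set_add_def' emb)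
  qed
  have coset: "(\<exists>i\<in>I. v = w \<oplus>\<^bsub>UE\<^esub> i) \<longleftrightarrow> I +>\<^bsub>UE\<^esub> v = I +>\<^bsub>UE\<^esub> w"
    if v: "v \<in> carrier UE" and w: "w \<in> carrier UE" for v w
  proof
    assume "\<exists>i\<in>I. v = w \<oplus>\<^bsub>UE\<^esub> i"
    then obtain i where i: "i \<in> I" "v = w \<oplus>\<^bsub>UE\<^esub> i" by blast
    then have "v \<ominus>\<^bsub>UE\<^esub> w = i"
      using w UE.lie_submoduleD(1)[OF N] by (simp add: a_minus_def UE.a_ac UE.r_neg)
    then show "I +>\<^bsub>UE\<^esub> v = I +>\<^bsub>UE\<^esub> w" using i v w UE.coset_eq_iff[OF N] by simp
  next
    assume "I +>\<^bsub>UE\<^esub> v = I +>\<^bsub>UE\<^esub> w"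
    then have "v \<ominus>\<^bsub>UE\<^esub> w \<in> I" using v w UE.coset_eq_iff[OF N] by simp
    moreover have "v = w \<oplus>\<^bsub>UE\<^esub> (v \<ominus>\<^bsub>UE\<^esub> w)"
      using v w by (simp add: a_minus_def UE.a_lcomm UE.r_neg)
    ultimately show "\<exists>i\<in>I. v = w \<oplus>\<^bsub>UE\<^esub> i" by blast
  qed
  \<comment> \<open>An element of \<open>I\<close> is the sum of the image of 0 and itself, so it
    lies in \<open>U_plus\<close>.\<close>
  have counit_I: "counit i = 0" if "i \<in> I" for i
  proof -
    have "i = proj (free_gen 0) \<oplus>\<^bsub>UE\<^esub> i"
      using UE.lie_submoduleD(1)[OF N that] env_emb_zero by (simp add: emb flip: U_zero)
    then show ?thesis
      using U_plus_iff[OF UE.lie_submoduleD(1)[OF N that]] that by blast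
  qed
  obtain \<epsilon> where \<epsilon>: "\<epsilon> \<in> lie_hom ?Q trivial_mod" "\<And>v. v \<in> carrier UE \<Longrightarrow> \<epsilon> (I +>\<^bsub>UE\<^esub> v) = counit v"
    using lie_quotient_universal[OF UE.lie_module_axioms lie_module_trivial N counit_hom] counit_I
    by auto
  have "\<epsilon> ?m \<noteq> 0"
    by (simp add: \<epsilon> counit_proj)
  moreover have "\<epsilon> C = 0 \<longleftrightarrow> C \<in> range (Upsilon ?Q ?m)" if "C \<in> carrier ?Q" for C
    using that by (auto simp: UE.quotient_carrier[OF N] \<epsilon>(2) U_plus_iff coset Ups)
  moreover have "inj (Upsilon ?Q ?m)"
  proof (rule injI)
    fix x y assume "Upsilon ?Q ?m x = Upsilon ?Q ?m y"
    then have "proj (free_gen x) \<ominus>\<^bsub>UE\<^esub> proj (free_gen y) \<in> I"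
      by (simp add: Ups UE.coset_eq_iff[OF N])
    then have "env_emb scale bracket (x - y) \<in> I"
      by (simp add: U_minus env_emb_diff)
    then have "env_emb scale bracket (x - y) = env_emb scale bracket 0"
      using I(4) by (auto simp: env_emb_zero U_zero)
    then show "x = y" using inj_env_emb by (auto dest: injD)
  qed
  moreover have "?m \<in> carrier ?Q"
    by (simp add: UE.quotient_carrier[OF N])
  ultimately show ?thesis
    unfolding U_quotient_pointed_eq good_pointed_iff_functional using Q \<epsilon>(1) by blast
qed

text \<open>The ideal is the annihilator of \<open>m\<close>, and the isomorphism is induced by
  letting the enveloping algebra act on \<open>m\<close>.\<close>

lemma good_pointed_from_LI:
  assumes "good_pointed scale bracket (M, m)"
  shows "\<exists>I\<in>LI scale bracket. pointed_isomorphic (U_quotient_pointed scale bracket I) (M, m)"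
proof -
  from assms obtain \<epsilon> where M: "lie_module scale bracket M" and m: "m \<in> carrier M"
    and inj: "inj (Upsilon M m)" and \<epsilon>: "\<epsilon> \<in> lie_hom M trivial_mod" "\<epsilon> m \<noteq> 0"
    and ker: "\<And>v. v \<in> carrier M \<Longrightarrow> \<epsilon> v = 0 \<longleftrightarrow> v \<in> range (Upsilon M m)"
    by (auto simp: good_pointed_iff_functional)
  interpret UE: lie_module scale bracket UE by (rule lie_module_U)
  interpret M: lie_module scale bracket M by (rule M)
  note hom = lie_homD[OF \<epsilon>(1), simplified]
  \<comment> \<open>The action of \<open>u\<close> on \<open>m\<close>, computed from a chosen
    representative; any other gives the same value by \<open>act_free_cong_proj\<close>.\<close>
  define \<psi> where "\<psi> u = M.act_free (SOME f. proj f = u) m" for u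
  have \<psi>: "\<psi> (proj f) = M.act_free f m" for f
    unfolding \<psi>_def by (rule M.act_free_cong_proj[OF _ m]) (rule someI, rule refl)
  have \<psi>_hom: "\<psi> \<in> lie_hom UE M"
    using m by (auto simp: lie_hom_def U_simps \<psi> M.act_free_add M.act_free_mult)
  define I where "I = {u \<in> carrier UE. \<psi> u = \<zero>\<^bsub>M\<^esub>}"
  have I_iff: "proj f \<in> I \<longleftrightarrow> M.act_free f m = \<zero>\<^bsub>M\<^esub>" for f
    by (simp add: I_def U_carrier \<psi>)
  \<comment> \<open>The leftmost letter of a nonempty word acts last, and \<epsilon> kills its
    result; only the constant coefficient survives.\<close>
  have \<epsilon>_act: "\<epsilon> (M.act_free f m) = Poly_Mapping.lookup f 0 * \<epsilon> m" for f
  proof (induction f rule: poly_mapping_add_induct)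
    case (single w c)
    show ?case
      using m by (cases "letters w")
        (auto simp: M.act_free_single M.act_word_def hom lookup_single when_def)
  next
    case (add f g)
    then show ?case using m by (simp add: M.act_free_add hom lookup_add distrib_right)
  qed
  have "additive_subgroup I UE"
    by (rule additive_subgroupI, rule group.subgroupI[OF UE.a_group], unfold a_inv_def[symmetric])
      (use m in \<open>auto simp: U_simps I_def \<psi> U_uminus M.act_free_uminus M.act_free_add intro: exI[of _ 0]\<close>)
  moreover have "r \<otimes>\<^bsub>UE\<^esub> a \<in> I" if "r \<in> carrier UE" "a \<in> I" for r a
    using that m by (auto simp: U_simps I_def \<psi> M.act_free_mult M.act_free_at_zero)
  ultimately have left: "left_ideal I UE"
    by (auto simp: left_ideal_def)
  \<comment> \<open>If the constant coefficient of \<open>f\<close> is zero, then \<epsilon> kills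
    the action of \<open>f\<close> on \<open>m\<close>, so that some \<open>x\<close> in
    \<open>g\<close> acts on \<open>m\<close> in the same way as \<open>f\<close>.\<close>
  have decomp: "\<exists>x. proj (f - free_gen x) \<in> I" if "Poly_Mapping.lookup f 0 = 0" for f
  proof -
    have "M.act_free f m \<in> range (Upsilon M m)"
      using ker[of "M.act_free f m"] m that by (simp add: \<epsilon>_act)
    then obtain x where "M.act_free f m = act M x m" by (auto simp: Upsilon_def)
    then have "proj (f - free_gen x) \<in> I"
      unfolding I_iff using m by (simp add: M.act_free_diff) (simp add: a_minus_def M.r_neg)
    then show ?thesis ..
  qed
  have "U_plus scale bracket = range (env_emb scale bracket) <+>\<^bsub>UE\<^esub> I"
  proof (intro subset_antisym subsetI)
    fix u assume "u \<in> U_plus scale bracket"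
    then obtain f where f: "u = proj f" "Poly_Mapping.lookup f 0 = 0" by (auto simp: U_plus_eq)
    with decomp obtain x where "proj (f - free_gen x) \<in> I" by blast
    moreover have "u = env_emb scale bracket x \<oplus>\<^bsub>UE\<^esub> proj (f - free_gen x)"
      by (simp add: f env_emb_def U_add)
    ultimately show "u \<in> range (env_emb scale bracket) <+>\<^bsub>UE\<^esub> I"
      by (auto simp: set_add_def')
  next
    fix u assume "u \<in> range (env_emb scale bracket) <+>\<^bsub>UE\<^esub> I"
    then obtain x i where u: "i \<in> I" "u = env_emb scale bracket x \<oplus>\<^bsub>UE\<^esub> i"
      by (auto simp: set_add_def')
    then obtain g where g: "i = proj g" by (auto simp: I_def U_carrier)
    then have "Poly_Mapping.lookup g 0 * \<epsilon> m = 0"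
      using u(1) \<epsilon>_act[of g] lie_hom_zero[OF M lie_module_trivial \<epsilon>(1)] by (simp add: I_iff)
    then show "u \<in> U_plus scale bracket"
      using \<epsilon>(2) by (auto simp: u(2) g env_emb_def U_add U_plus_eq lookup_add intro!: exI[of _ "free_gen x + g"])
  qed
  moreover have "range (env_emb scale bracket) \<inter> I = {\<zero>\<^bsub>UE\<^esub>}"
  proof -
    have "x = 0" if "proj (free_gen x) \<in> I" for x
    proof -
      have "act M 0 m = \<zero>\<^bsub>M\<^esub>" using M.act_scale_left[OF m, of 0 0] m by simp
      then have "Upsilon M m x = Upsilon M m 0"
        using that m by (simp add: I_iff Upsilon_def)
      then show ?thesis using inj by (auto dest: injD)
    qed
    moreover have "env_emb scale bracket 0 \<in> range (env_emb scale bracket) \<inter> I"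
      using I_iff[of 0] rangeI[of "env_emb scale bracket" 0] by (simp add: env_emb_zero)
    ultimately show ?thesis
      using env_emb_zero by (auto simp: env_emb_def U_zero)
  qed
  ultimately have LI: "I \<in> LI scale bracket"
    using left by (simp add: LI_def)
  \<comment> \<open>Surjectivity: subtracting the multiple \<open>c\<close> of \<open>m\<close>
    brings \<open>v\<close> into the kernel of \<epsilon>, which is the image of
    \<open>Upsilon M m\<close>; hence \<open>v\<close> comes from an element of \<open>g\<close>
    plus a constant.\<close>
  have "v \<in> \<psi> ` carrier UE" if v: "v \<in> carrier M" for v
  proof -
    define c where "c = \<epsilon> v / \<epsilon> m"
    have "\<epsilon> (v \<oplus>\<^bsub>M\<^esub> (- c) \<odot>\<^bsub>M\<^esub> m) = 0"
      using v m \<epsilon>(2) by (simp add: hom c_def)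
    then obtain x where x: "v \<oplus>\<^bsub>M\<^esub> (- c) \<odot>\<^bsub>M\<^esub> m = act M x m"
      using ker[of "v \<oplus>\<^bsub>M\<^esub> (- c) \<odot>\<^bsub>M\<^esub> m"] v m by (auto simp: Upsilon_def)
    have "act M x m \<oplus>\<^bsub>M\<^esub> c \<odot>\<^bsub>M\<^esub> m = v \<oplus>\<^bsub>M\<^esub> ((- c) \<odot>\<^bsub>M\<^esub> m \<oplus>\<^bsub>M\<^esub> c \<odot>\<^bsub>M\<^esub> m)"
      using v m by (simp add: M.a_assoc flip: x)
    also have "\<dots> = v"
      using v m by (simp flip: M.lie_mod_distribs(1))
    finally have "\<psi> (proj (free_gen x + free_const c)) = v"
      using m by (simp add: \<psi> M.act_free_add)
    then show ?thesis by (auto simp: U_carrier)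
  qed
  then have "\<psi> ` carrier UE = carrier M"
    using lie_homD(1)[OF \<psi>_hom] by blast
  then obtain g where g: "g \<in> lie_module_iso (lie_quotient UE I) M"
    "\<And>v. v \<in> carrier UE \<Longrightarrow> g (I +>\<^bsub>UE\<^esub> v) = \<psi> v"
    using lie_quotient_iso[OF UE.lie_module_axioms M lie_submodule_left_ideal[OF LI] \<psi>_hom]
    by (auto simp: I_def)
  have "g (I +>\<^bsub>UE\<^esub> proj 1) = m"
    using g(2)[of "proj 1"] m by (simp add: U_carrier \<psi>)
  then have "pointed_isomorphic (U_quotient_pointed scale bracket I) (M, m)"
    using g(1) by (auto simp: pointed_isomorphic_def U_quotient_pointed_eq)
  then show ?thesis using LI by blast
qed

section \<open>Uniqueness of the left ideal and the bijection\<close>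

lemma pointed_isomorphic_U_quotient_subset:
  assumes I: "I \<in> LI scale bracket" and J: "J \<in> LI scale bracket"
    and iso: "pointed_isomorphic (U_quotient_pointed scale bracket I) (U_quotient_pointed scale bracket J)"
  shows "I \<subseteq> J"
proof
  interpret UE: lie_module scale bracket UE by (rule lie_module_U)
  note NI = lie_submodule_left_ideal[OF I] and NJ = lie_submodule_left_ideal[OF J]
  note QI = UE.lie_module_quotient[OF NI] and QJ = UE.lie_module_quotient[OF NJ]
  have proj [simp]: "proj f \<in> carrier UE" for f by (simp add: U_carrier)
  obtain f where f: "f \<in> lie_hom (lie_quotient UE I) (lie_quotient UE J)"
    "f (I +>\<^bsub>UE\<^esub> proj 1) = J +>\<^bsub>UE\<^esub> proj 1"
    using iso by (auto simp: pointed_isomorphic_def U_quotient_pointed_eq lie_module_iso_eq)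
  have act: "N +>\<^bsub>UE\<^esub> proj p = lie_module.act_free (lie_quotient UE N) p (N +>\<^bsub>UE\<^esub> proj 1)"
    if "lie_submodule N UE" for N p
    using lie_hom_act_free[OF UE.lie_module_axioms UE.lie_module_quotient[OF that] UE.coset_hom[OF that],
        of "proj 1" p]
    by (simp add: act_free_U)
  \<comment> \<open>Both base points generate, so a homomorphism that matches them sends the class
    of \<open>p\<close> modulo \<open>I\<close> to its class modulo \<open>J\<close>. An element of
    \<open>I\<close> then has zero class modulo \<open>J\<close>.\<close>
  have fp: "f (I +>\<^bsub>UE\<^esub> proj p) = J +>\<^bsub>UE\<^esub> proj p" for p
  proof -
    have "I +>\<^bsub>UE\<^esub> proj 1 \<in> carrier (lie_quotient UE I)"
      by (simp add: UE.quotient_carrier[OF NI])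
    from lie_hom_act_free[OF QI QJ f(1) this, of p] show ?thesis
      unfolding f(2) act[OF NI, of p, symmetric] act[OF NJ, of p, symmetric] .
  qed
  fix u assume u: "u \<in> I"
  then obtain p where p: "u = proj p"
    using UE.lie_submoduleD(1)[OF NI] by (auto simp: U_carrier)
  have "I +>\<^bsub>UE\<^esub> proj p = \<zero>\<^bsub>lie_quotient UE I\<^esub>"
    using u by (simp add: p UE.coset_eq_zero_iff[OF NI])
  then have "J +>\<^bsub>UE\<^esub> proj p = \<zero>\<^bsub>lie_quotient UE J\<^esub>"
    using fp[of p] lie_hom_zero[OF QI QJ f(1)] by simp
  then show "u \<in> J"
    by (simp add: p UE.coset_eq_zero_iff[OF NJ])
qed

lemma pointed_isomorphic_sym:
  assumes "good_pointed scale bracket P" "pointed_isomorphic P Q"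
  shows "pointed_isomorphic Q P"
proof -
  obtain M m N n where PQ: "P = (M, m)" "Q = (N, n)" by (cases P; cases Q)
  with assms obtain f where f: "f \<in> lie_module_iso M N" "f m = n"
    and M: "lie_module scale bracket M" "m \<in> carrier M"
    by (auto simp: pointed_isomorphic_def good_pointed_def)
  then have "inv_into (carrier M) f n = m"
    by (auto simp: lie_module_iso_eq bij_betw_def)
  then show ?thesis
    using lie_module_iso_inv[OF M(1) f(1)] by (auto simp: PQ pointed_isomorphic_def)
qed

lemma equiv_good_pointed:
  "equiv {P. good_pointed scale bracket P} (good_pointed_iso_rel scale bracket)"
proof (rule equivI)
  show "good_pointed_iso_rel scale bracket \<subseteq> {P. good_pointed scale bracket P} \<times> {P. good_pointed scale bracket P}"
    by (auto simp: good_pointed_iso_rel_def)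
  show "refl_on {P. good_pointed scale bracket P} (good_pointed_iso_rel scale bracket)"
    by (auto simp: refl_on_def good_pointed_iso_rel_def pointed_isomorphic_def
        intro!: bexI[OF _ lie_module_iso_id])
  show "sym (good_pointed_iso_rel scale bracket)"
    by (auto simp: sym_def good_pointed_iso_rel_def intro: pointed_isomorphic_sym)
  show "trans (good_pointed_iso_rel scale bracket)"
    unfolding trans_def good_pointed_iso_rel_def pointed_isomorphic_def
    by clarsimp (metis comp_apply lie_module_iso_comp)
qed

end

text \<open>The first conjunct is well-definedness. A set of isomorphism classes has to fix a type
  of elements, and the bijection uses the type in which the quotients of the enveloping algebra
  live. The last conjunct shows that this misses nothing: a good pointed module over any type is
  isomorphic to one of these quotients.\<close>

theorem theorem14:
  fixes scale :: "'k::field_char_0 \<Rightarrow> 'g::ab_group_add \<Rightarrow> 'g"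
    and bracket :: "'g \<Rightarrow> 'g \<Rightarrow> 'g"
  assumes "lie_algebra scale bracket"
  shows "(\<forall>I\<in>LI scale bracket. good_pointed scale bracket (U_quotient_pointed scale bracket I)) \<and>
    bij_betw (Theta scale bracket) (LI scale bracket) (GM scale bracket) \<and>
    (\<forall>P :: ('k, 'g, 'm) pointed_lie_mod. good_pointed scale bracket P \<longrightarrow>
       (\<exists>I\<in>LI scale bracket. pointed_isomorphic (U_quotient_pointed scale bracket I) P))"
proof (intro conjI ballI allI impI)
  interpret lie_algebra scale bracket by fact
  let ?U = "U_quotient_pointed scale bracket" and ?r = "good_pointed_iso_rel scale bracket"
  show good: "good_pointed scale bracket (?U I)" if "I \<in> LI scale bracket" for I
    using that by (rule good_pointed_U_quotient)
  show "\<exists>I\<in>LI scale bracket. pointed_isomorphic (?U I) P"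
    if "good_pointed scale bracket P" for P :: "('k, 'g, 'm) pointed_lie_mod"
    using good_pointed_from_LI[of "fst P" "snd P"] that by simp
  \<comment> \<open>Equality of classes becomes isomorphism of representatives. Injectivity and
    surjectivity of \<open>Theta\<close> are both read off from this.\<close>
  have Theta_eq: "Theta scale bracket I = ?r `` {P} \<longleftrightarrow> pointed_isomorphic (?U I) P"
    if "I \<in> LI scale bracket" "good_pointed scale bracket P" for I P
    using eq_equiv_class_iff[OF equiv_good_pointed, of "?U I" P] good that
    by (simp add: Theta_def good_pointed_iso_rel_def)
  show "bij_betw (Theta scale bracket) (LI scale bracket) (GM scale bracket)"
  proof (rule bij_betwI')
    fix I J assume IJ: "I \<in> LI scale bracket" "J \<in> LI scale bracket"
    show "Theta scale bracket I = Theta scale bracket J \<longleftrightarrow> I = J"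
    proof
      assume "Theta scale bracket I = Theta scale bracket J"
      then have "pointed_isomorphic (?U I) (?U J)"
        using Theta_eq[OF IJ(1) good[OF IJ(2)]] by (simp add: Theta_def)
      then show "I = J"
        using IJ pointed_isomorphic_sym[OF good[OF IJ(1)]]
        by (intro subset_antisym pointed_isomorphic_U_quotient_subset)
    qed simp
  next
    fix I assume "I \<in> LI scale bracket"
    then show "Theta scale bracket I \<in> GM scale bracket"
      using good by (simp add: Theta_def GM_def quotientI)
  next
    fix C :: "('k, 'g, ('k, 'g) free_alg set set) pointed_lie_mod set"
    assume "C \<in> GM scale bracket"
    then obtain P where P: "good_pointed scale bracket P" "C = ?r `` {P}"
      by (auto simp: GM_def elim!: quotientE)
    then obtain I where "I \<in> LI scale bracket" "pointed_isomorphic (?U I) P"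
      using good_pointed_from_LI[of "fst P" "snd P"] by auto
    then show "\<exists>I\<in>LI scale bracket. C = Theta scale bracket I"
      using Theta_eq P by blast
  qed
qed

end
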